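(* The following three statements hold. (1) Let $h = h_5 + R_6 \colon (\mathbf{R}^2,\mathbf{0}) \to (\mathbf{R},0)$ be a function-germ, where $h_5$ is a non-zero homogeneous harmonic polynomial of degree $5$ and $R_6$ is a function-germ with $\mathrm{ord}(R_6) \ge 6$. Then $h$ is right-equivalent, by a linear conformal diffeomorphism-germ, to $f_5 + \tilde{R}_6$ for some function-germ $\tilde{R}_6$ with $\mathrm{ord}(\tilde{R}_6) \ge 6$. (2) For any homogeneous polynomial $\rho_6$ of degree $6$ in $(x,y)$ and any function-germ $R_7$ with $\mathrm{ord}(R_7) \ge 7$, the function-germ $f_5 + \rho_6 + R_7$ is right-equivalent to $f_5 + \frac{c}{6!}x^6$, where $c = \Delta^3 \rho_6 \in \mathbf{R}$. (3) For any $c, \tilde{c} \in \mathbf{R}$, the germ $f_5 + c x^6$ is right-equivalent to $f_5 + \tilde{c} x^6$ if and only if $c = \tilde{c}$.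
   Context: All function-germs are germs at the origin of $C^\infty$ functions on $\mathbf{R}^2$ with coordinates $(x,y)$, vanishing at the origin. $f_5 = \mathrm{Re}\,(x+iy)^5$, where $i = \sqrt{-1}$. $\Delta = \frac{\partial^2}{\partial x^2} + \frac{\partial^2}{\partial y^2}$ is the Laplacian; a function $h$ is harmonic if $\Delta h = 0$. The order $\mathrm{ord}(R)$ of a germ $R$ at the origin is the lowest degree of a non-zero term in its Taylor series at $\mathbf{0}$ (and $+\infty$ if the Taylor series is zero). Two germs $h_1,h_2$ are right-equivalent if there is a $C^\infty$ diffeomorphism-germ $\tau \colon (\mathbf{R}^2,\mathbf{0}) \to (\mathbf{R}^2,\mathbf{0})$ with $h_1 \circ \tau = h_2$; they are right-equivalent by a linear conformal diffeomorphism-germ if $\tau$ can be taken to be a non-zero scalar multiple of an orthogonal linear map. *)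

theory Defs
  imports "HOL-Analysis.Analysis" "HOL-Library.Extended_Nat"
begin

text \<open>
  A germ at the origin is represented by a total function, constrained only on some neighbourhood
  of the origin; equality of germs is equality eventually in \<open>nhds 0\<close>. The notions concerning
  germs do not depend on the choice of representatives.
\<close>

type_synonym plane = "real \<times> real"

text \<open>For open \<open>S\<close> in finite dimension this is the usual class of \<open>k\<close> times continuously
  differentiable maps; for other \<open>S\<close> it is not meaningful, as derivatives are taken in the
  ambient space.\<close>

primrec Ck_on :: "nat \<Rightarrow> 'a::real_normed_vector set \<Rightarrow> ('a \<Rightarrow> 'b::real_normed_vector) \<Rightarrow> bool"
where
  "Ck_on 0 S f \<longleftrightarrow> continuous_on S f"
| "Ck_on (Suc k) S f \<longleftrightarrow>
     (\<forall>p\<in>S. f differentiable (at p)) \<and>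
     (\<forall>v. Ck_on k S (\<lambda>p. frechet_derivative f (at p) v))"

definition smooth_on :: "'a::real_normed_vector set \<Rightarrow> ('a \<Rightarrow> 'b::real_normed_vector) \<Rightarrow> bool"
where
  "smooth_on S f \<longleftrightarrow> (\<forall>k. Ck_on k S f)"

definition function_germ :: "(plane \<Rightarrow> real) \<Rightarrow> bool" where
  "function_germ h \<longleftrightarrow> h 0 = 0 \<and> (\<exists>U. open U \<and> 0 \<in> U \<and> smooth_on U h)"

definition diffeo_germ :: "(plane \<Rightarrow> plane) \<Rightarrow> bool" where
  "diffeo_germ \<tau> \<longleftrightarrow> \<tau> 0 = 0 \<and>
     (\<exists>U V \<sigma>. open U \<and> open V \<and> 0 \<in> U \<and> homeomorphism U V \<tau> \<sigma> \<and>
        smooth_on U \<tau> \<and> smooth_on V \<sigma>)"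

definition right_equivalent_via ::
  "(plane \<Rightarrow> plane) \<Rightarrow> (plane \<Rightarrow> real) \<Rightarrow> (plane \<Rightarrow> real) \<Rightarrow> bool" where
  "right_equivalent_via \<tau> h1 h2 \<longleftrightarrow>
     diffeo_germ \<tau> \<and> (\<forall>\<^sub>F p in nhds 0. h1 (\<tau> p) = h2 p)"

definition right_equivalent :: "(plane \<Rightarrow> real) \<Rightarrow> (plane \<Rightarrow> real) \<Rightarrow> bool" where
  "right_equivalent h1 h2 \<longleftrightarrow> (\<exists>\<tau>. right_equivalent_via \<tau> h1 h2)"

definition linear_conformal :: "(plane \<Rightarrow> plane) \<Rightarrow> bool" where
  "linear_conformal \<tau> \<longleftrightarrow>
     (\<exists>r A. r \<noteq> 0 \<and> orthogonal_transformation A \<and> \<tau> = (\<lambda>p. r *\<^sub>R A p))"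

definition linear_conformally_right_equivalent ::
  "(plane \<Rightarrow> real) \<Rightarrow> (plane \<Rightarrow> real) \<Rightarrow> bool" where
  "linear_conformally_right_equivalent h1 h2 \<longleftrightarrow>
     (\<exists>\<tau>. linear_conformal \<tau> \<and> right_equivalent_via \<tau> h1 h2)"

definition partial_x :: "(plane \<Rightarrow> real) \<Rightarrow> plane \<Rightarrow> real" where
  "partial_x f p = deriv (\<lambda>t. f (t, snd p)) (fst p)"

definition partial_y :: "(plane \<Rightarrow> real) \<Rightarrow> plane \<Rightarrow> real" where
  "partial_y f p = deriv (\<lambda>t. f (fst p, t)) (snd p)"

definition taylor_coeff :: "(plane \<Rightarrow> real) \<Rightarrow> nat \<Rightarrow> nat \<Rightarrow> real" where
  "taylor_coeff f i j = (partial_x ^^ i) ((partial_y ^^ j) f) 0 / (fact i * fact j)"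

text \<open>The infimum of the empty set in \<^typ>\<open>enat\<close> is \<open>\<infinity>\<close>.\<close>

definition germ_order :: "(plane \<Rightarrow> real) \<Rightarrow> enat" where
  "germ_order f = Inf {enat (i + j) | i j. taylor_coeff f i j \<noteq> 0}"

text \<open>Since \<^const>\<open>deriv\<close> is total, these two are meaningful only for functions that are twice
  differentiable everywhere; they are only applied to polynomials.\<close>

definition laplacian :: "(plane \<Rightarrow> real) \<Rightarrow> plane \<Rightarrow> real" where
  "laplacian f p = partial_x (partial_x f) p + partial_y (partial_y f) p"

definition harmonic :: "(plane \<Rightarrow> real) \<Rightarrow> bool" where
  "harmonic f \<longleftrightarrow> (\<forall>p. laplacian f p = 0)"

text \<open>The zero polynomial is homogeneous of every degree.\<close>

definition homogeneous_polynomial :: "nat \<Rightarrow> (plane \<Rightarrow> real) \<Rightarrow> bool" where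
  "homogeneous_polynomial d f \<longleftrightarrow>
     (\<exists>a. \<forall>x y. f (x, y) = (\<Sum>i\<le>d. a i * x ^ i * y ^ (d - i)))"

definition f5 :: "plane \<Rightarrow> real" where
  "f5 p = Re ((of_real (fst p) + \<i> * of_real (snd p)) ^ 5)"

end

theory Submission
  imports Defs
begin

text \<open>
  Write \<open>z = x + i y\<close>, so that \<open>f5 = Re z\<^sup>5\<close> has Jacobian ideal generated by the real and imaginary
  parts of \<open>z\<^sup>4\<close>. The real functions \<open>Re (z\<^sup>4 (\<alpha> z\<^sup>2 + \<beta> z cnj z + \<gamma> (cnj z)\<^sup>2))\<close> with
  smooth complex coefficients exhaust the germs of order at least 6 up to a multiple of
  \<open>(x\<^sup>2 + y\<^sup>2)\<^sup>3\<close>, and all germs of order at least 7, where in addition the coefficients vanish at 0.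
  Substituting \<open>z + \<alpha> z\<^sup>2 + \<beta> z cnj z + \<gamma> (cnj z)\<^sup>2\<close> into \<open>f5 + \<kappa> x\<^sup>6\<close> with unknown functions
  \<open>\<alpha>, \<beta>, \<gamma>\<close> changes it by \<open>Re (5 z\<^sup>4 (\<dots>))\<close> plus terms of order 7, so a prescribed change
  \<open>Re (z\<^sup>4 (a z\<^sup>2 + b z cnj z + c (cnj z)\<^sup>2))\<close> leads to equations \<open>5 (\<alpha>, \<beta>, \<gamma>) + o(1) = (a, b, c)\<close>,
  solved by the implicit function theorem; no homotopy of vector fields is needed. For the
  invariance of the modulus, the linear part of an equivalence preserves \<open>f5\<close> and is therefore
  orthogonal, and \<open>\<Delta>\<^sup>3\<close> of the sextic part does not see its quadratic part.
\<close>

section \<open>Calculus of smooth maps\<close>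

text \<open>In degree 6 the obstruction is one-dimensional. As \<Delta> is 4 times the mixed
  derivative in \<open>z\<close> and \<open>cnj z\<close>, \<Delta>^3 of a sextic form reads off its
  coefficient at \<open>z^3 (cnj z)^3\<close>, which is zero for \<open>z^6\<close>,
  \<open>z^5 cnj z\<close>, \<open>z^4 (cnj z)^2\<close> and their conjugates. In degree 7 the
  obstruction is gone because \<open>z |z|^6 = z^4 (cnj z)^3\<close>; the extra factor
  \<open>cnj z\<close> is one of those that make the coefficients vanish at 0. The delicate point of
  the substitution is that its error must be divided by \<open>z^4\<close> smoothly in the point and
  in the unknown coefficients at once. Powers of the ideal are therefore formed relative to a map
  \<pi>. On the product of the plane with the space of coefficients \<pi> is the projection to the
  plane, and the error, being polynomial, lies in the seventh power by counting factors; Hadamard's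
  lemma is needed on the plane only. After the division the error vanishes over the origin for every
  value of the unknowns, so the derivative of the equations in the unknowns is there 5 times the
  identity.\<close>

lemma Ck_on_subset:
  assumes "Ck_on k T f" "S \<subseteq> T"
  shows "Ck_on k S f"
  using assms by (induction k arbitrary: f) (auto intro: continuous_on_subset)

lemma Ck_on_cong:
  assumes "open S" "\<And>p. p \<in> S \<Longrightarrow> f p = g p"
  shows "Ck_on k S f \<longleftrightarrow> Ck_on k S g"
  using assms(2)
proof (induction k arbitrary: f g)
  case 0
  then show ?case by (auto cong: continuous_on_cong)
next
  case (Suc k)
  have dfr: "f differentiable (at p) \<longleftrightarrow> g differentiable (at p)" if "p \<in> S" for p
    using Suc.prems that assms(1) unfolding differentiable_def
    by (metis has_derivative_transform_within_open)
  have "frechet_derivative f (at p) = frechet_derivative g (at p)" if "p \<in> S" for p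
  proof -
    have "(f has_derivative D) (at p) \<longleftrightarrow> (g has_derivative D) (at p)" for D
      using Suc.prems that assms(1) by (metis has_derivative_transform_within_open)
    then show ?thesis unfolding frechet_derivative_def by simp
  qed
  then have "Ck_on k S (\<lambda>p. frechet_derivative f (at p) v)
      \<longleftrightarrow> Ck_on k S (\<lambda>p. frechet_derivative g (at p) v)" for v
    by (intro Suc.IH) auto
  then show ?case using dfr by auto
qed

text \<open>\<open>frechet_derivative\<close> is a choice operator; uniqueness of derivatives lets
  any explicit formula \<open>D\<close> stand for it, and openness of \<open>S\<close> carries the
  exchange to the next level. The inductions below supply such formulas.\<close>

lemma Ck_on_SucI:
  assumes "open S" "\<And>p. p \<in> S \<Longrightarrow> (f has_derivative D p) (at p)"
    and "\<And>v. Ck_on k S (\<lambda>p. D p v)"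
  shows "Ck_on (Suc k) S f"
proof -
  have "frechet_derivative f (at p) = D p" if "p \<in> S" for p
    by (rule frechet_derivative_at[OF assms(2)[OF that], symmetric])
  then have "Ck_on k S (\<lambda>p. frechet_derivative f (at p) v) \<longleftrightarrow> Ck_on k S (\<lambda>p. D p v)" for v
    by (intro Ck_on_cong[OF assms(1)]) simp
  then show ?thesis using assms(2,3) by (auto simp: differentiable_def)
qed

lemma Ck_on_Suc_derivative:
  assumes "Ck_on (Suc k) S f" "p \<in> S"
  shows "(f has_derivative frechet_derivative f (at p)) (at p)"
  using assms by (simp add: frechet_derivative_works[symmetric])

lemma Ck_on_imp_continuous_on:
  assumes "open S" "Ck_on k S f"
  shows "continuous_on S f"
proof (cases k)
  case (Suc m)
  then show ?thesis using assms
    by (auto simp: continuous_on_eq_continuous_at intro: differentiable_imp_continuous_within)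
qed (use assms in simp)

lemma Ck_on_Suc_lower:
  assumes "open S" "Ck_on (Suc k) S f"
  shows "Ck_on k S f"
  using assms(2)
proof (induction k arbitrary: f)
  case 0
  then show ?case using Ck_on_imp_continuous_on[OF assms(1)] Ck_on.simps(1) by blast
next
  case (Suc k)
  show ?case unfolding Ck_on.simps(2)[of k]
  proof (intro conjI allI)
    show "\<forall>p\<in>S. f differentiable (at p)" using Suc.prems by simp
    show "Ck_on k S (\<lambda>p. frechet_derivative f (at p) v)" for v
      using Suc.prems Suc.IH Ck_on.simps(2)[of "Suc k"] by blast
  qed
qed

lemma Ck_on_const: "Ck_on k S (\<lambda>p. c)"
  by (induction k arbitrary: c) auto

lemma Ck_on_bounded_linear_compose:
  assumes "open S" "bounded_linear L" "Ck_on k S f"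
  shows "Ck_on k S (\<lambda>p. L (f p))"
  using assms(3)
proof (induction k arbitrary: f)
  case 0
  then show ?case using bounded_linear.continuous_on[OF assms(2)] by simp
next
  case (Suc k)
  show ?case
  proof (rule Ck_on_SucI[OF assms(1)])
    show "((\<lambda>p. L (f p)) has_derivative (\<lambda>v. L (frechet_derivative f (at p) v))) (at p)" if "p \<in> S" for p
      using bounded_linear.has_derivative[OF assms(2) Ck_on_Suc_derivative[OF Suc.prems that]] .
    show "Ck_on k S (\<lambda>p. L (frechet_derivative f (at p) v))" for v
      by (rule Suc.IH) (use Suc.prems in simp)
  qed
qed

lemma Ck_on_bounded_linear:
  assumes "open S" "bounded_linear L"
  shows "Ck_on k S L"
proof (cases k)
  case 0
  then show ?thesis using assms(2) by (simp add: linear_continuous_on)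
next
  case (Suc m)
  show ?thesis unfolding Suc
    by (rule Ck_on_SucI[OF assms(1) bounded_linear_imp_has_derivative[OF assms(2)] Ck_on_const])
qed

lemma Ck_on_add:
  assumes "open S" "Ck_on k S f" "Ck_on k S g"
  shows "Ck_on k S (\<lambda>p. f p + g p)"
  using assms(2,3)
proof (induction k arbitrary: f g)
  case 0
  then show ?case by (simp add: continuous_on_add)
next
  case (Suc k)
  show ?case
  proof (rule Ck_on_SucI[OF assms(1)])
    show "((\<lambda>p. f p + g p) has_derivative
        (\<lambda>v. frechet_derivative f (at p) v + frechet_derivative g (at p) v)) (at p)" if "p \<in> S" for p
      by (intro has_derivative_add Ck_on_Suc_derivative[OF Suc.prems(1) that]
          Ck_on_Suc_derivative[OF Suc.prems(2) that])
    show "Ck_on k S (\<lambda>p. frechet_derivative f (at p) v + frechet_derivative g (at p) v)" for v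
      using Suc.prems by (intro Suc.IH) simp_all
  qed
qed

lemma Ck_on_sum:
  assumes "open S" "\<And>i. i \<in> I \<Longrightarrow> Ck_on k S (f i)"
  shows "Ck_on k S (\<lambda>p. \<Sum>i\<in>I. f i p)"
  using assms(2)
  by (induction I rule: infinite_finite_induct) (simp_all add: Ck_on_const Ck_on_add[OF assms(1)])

lemma Ck_on_bilinear:
  assumes "open S" "bounded_bilinear B" "Ck_on k S f" "Ck_on k S g"
  shows "Ck_on k S (\<lambda>p. B (f p) (g p))"
  using assms(3,4)
proof (induction k arbitrary: f g)
  case 0
  then show ?case using bounded_bilinear.continuous_on[OF assms(2)] by simp
next
  case (Suc k)
  show ?case
  proof (rule Ck_on_SucI[OF assms(1)])
    show "((\<lambda>p. B (f p) (g p)) has_derivative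
        (\<lambda>v. B (f p) (frechet_derivative g (at p) v) + B (frechet_derivative f (at p) v) (g p))) (at p)"
      if "p \<in> S" for p
      by (intro bounded_bilinear.FDERIV[OF assms(2)] Ck_on_Suc_derivative[OF Suc.prems(1) that]
          Ck_on_Suc_derivative[OF Suc.prems(2) that])
    have "Ck_on k S f" "Ck_on k S g"
      using Suc.prems Ck_on_Suc_lower[OF assms(1)] by blast+
    then show "Ck_on k S (\<lambda>p. B (f p) (frechet_derivative g (at p) v)
        + B (frechet_derivative f (at p) v) (g p))" for v
      using Suc.prems by (intro Ck_on_add[OF assms(1)] Suc.IH) simp_all
  qed
qed

text \<open>\<open>Ck_on\<close> controls derivatives only along a fixed vector. Where the vector
  moves with the point, as in the chain rule, this expansion reduces it to fixed basis
  vectors.\<close>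

lemma linear_expand_Basis:
  fixes L :: "'a::euclidean_space \<Rightarrow> 'b::real_vector"
  assumes "linear L"
  shows "L v = (\<Sum>b\<in>Basis. (v \<bullet> b) *\<^sub>R L b)"
proof -
  have "L v = L (\<Sum>b\<in>Basis. (v \<bullet> b) *\<^sub>R b)" by (simp add: euclidean_representation)
  also have "\<dots> = (\<Sum>b\<in>Basis. (v \<bullet> b) *\<^sub>R L b)"
    by (simp add: linear_sum[OF assms] linear_scale[OF assms])
  finally show ?thesis .
qed

lemma Ck_on_inner_scaleR:
  fixes c :: "'a::euclidean_space \<Rightarrow> 'b::euclidean_space"
  assumes "open S" "Ck_on k S f" "\<And>b. b \<in> Basis \<Longrightarrow> Ck_on k S (g b)"
  shows "Ck_on k S (\<lambda>p. \<Sum>b\<in>Basis. (f p \<bullet> b) *\<^sub>R g b p)"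
  using assms
  by (intro Ck_on_sum Ck_on_bilinear[OF assms(1) bounded_bilinear_scaleR]
      Ck_on_bounded_linear_compose[OF assms(1) bounded_linear_inner_left]) auto

lemma Ck_on_compose:
  fixes f :: "'b::euclidean_space \<Rightarrow> 'c::real_normed_vector"
  assumes "open S" "open T" "Ck_on k T f" "Ck_on k S g" "g ` S \<subseteq> T"
  shows "Ck_on k S (\<lambda>p. f (g p))"
  using assms(3,4)
proof (induction k arbitrary: f)
  case 0
  then show ?case using assms(5) by (auto intro: continuous_on_compose2)
next
  case (Suc k)
  let ?D = "\<lambda>p v. frechet_derivative f (at (g p)) (frechet_derivative g (at p) v)"
  show ?case
  proof (rule Ck_on_SucI[OF assms(1)])
    show D: "((\<lambda>p. f (g p)) has_derivative ?D p) (at p)" if "p \<in> S" for p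
      using Suc.prems that assms(5)
        diff_chain_at[OF Ck_on_Suc_derivative[of k S g p] Ck_on_Suc_derivative[of k T f "g p"]]
      by (auto simp: o_def)
    have gk: "Ck_on k S g" using Suc.prems Ck_on_Suc_lower[OF assms(1)] by blast
    have "Ck_on k S (\<lambda>p. \<Sum>b\<in>Basis. (frechet_derivative g (at p) v \<bullet> b) *\<^sub>R
        frechet_derivative f (at (g p)) b)" for v
      using Suc gk by (intro Ck_on_inner_scaleR assms(1) Suc.IH) auto
    moreover have "?D p v = (\<Sum>b\<in>Basis. (frechet_derivative g (at p) v \<bullet> b) *\<^sub>R
        frechet_derivative f (at (g p)) b)" if "p \<in> S" for p v
      using Suc.prems that assms(5)
      by (intro linear_expand_Basis has_derivative_linear[OF Ck_on_Suc_derivative[of k T]]) auto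
    ultimately show "Ck_on k S (\<lambda>p. ?D p v)" for v
      by (subst Ck_on_cong[OF assms(1)])
  qed
qed

section \<open>Closure properties of smooth maps\<close>

lemma smooth_on_subset: "smooth_on T f \<Longrightarrow> S \<subseteq> T \<Longrightarrow> smooth_on S f"
  unfolding smooth_on_def using Ck_on_subset by blast

lemma smooth_on_cong:
  "open S \<Longrightarrow> (\<And>p. p \<in> S \<Longrightarrow> f p = g p) \<Longrightarrow> smooth_on S f \<longleftrightarrow> smooth_on S g"
  unfolding smooth_on_def using Ck_on_cong by blast

lemma smooth_on_const: "smooth_on S (\<lambda>p. c)"
  unfolding smooth_on_def by (simp add: Ck_on_const)

lemma smooth_on_linear_compose:
  "open S \<Longrightarrow> bounded_linear L \<Longrightarrow> smooth_on S f \<Longrightarrow> smooth_on S (\<lambda>p. L (f p))"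
  unfolding smooth_on_def by (simp add: Ck_on_bounded_linear_compose)

lemma smooth_on_linear: "open S \<Longrightarrow> bounded_linear L \<Longrightarrow> smooth_on S L"
  unfolding smooth_on_def by (simp add: Ck_on_bounded_linear)

lemma smooth_on_ident: "open S \<Longrightarrow> smooth_on S (\<lambda>p. p)"
  by (rule smooth_on_linear) (auto intro: bounded_linear_ident)

lemma smooth_on_fst: "open S \<Longrightarrow> smooth_on S f \<Longrightarrow> smooth_on S (\<lambda>p. fst (f p))"
  by (rule smooth_on_linear_compose[OF _ bounded_linear_fst])

lemma smooth_on_snd: "open S \<Longrightarrow> smooth_on S f \<Longrightarrow> smooth_on S (\<lambda>p. snd (f p))"
  by (rule smooth_on_linear_compose[OF _ bounded_linear_snd])

lemma smooth_on_of_real: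
  "open S \<Longrightarrow> smooth_on S f \<Longrightarrow> smooth_on S (\<lambda>p. of_real (f p) :: 'a::real_normed_algebra_1)"
  by (rule smooth_on_linear_compose[OF _ bounded_linear_of_real])

lemma smooth_on_Re: "open S \<Longrightarrow> smooth_on S f \<Longrightarrow> smooth_on S (\<lambda>p. Re (f p))"
  by (rule smooth_on_linear_compose[OF _ bounded_linear_Re])

lemma smooth_on_Im: "open S \<Longrightarrow> smooth_on S f \<Longrightarrow> smooth_on S (\<lambda>p. Im (f p))"
  by (rule smooth_on_linear_compose[OF _ bounded_linear_Im])

lemma smooth_on_cnj: "open S \<Longrightarrow> smooth_on S f \<Longrightarrow> smooth_on S (\<lambda>p. cnj (f p))"
  by (rule smooth_on_linear_compose[OF _ bounded_linear_cnj])

lemma smooth_on_add: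
  "open S \<Longrightarrow> smooth_on S f \<Longrightarrow> smooth_on S g \<Longrightarrow> smooth_on S (\<lambda>p. f p + g p)"
  unfolding smooth_on_def by (simp add: Ck_on_add)

lemma smooth_on_minus: "open S \<Longrightarrow> smooth_on S f \<Longrightarrow> smooth_on S (\<lambda>p. - f p)"
  by (rule smooth_on_linear_compose[OF _ bounded_linear_minus[OF bounded_linear_ident]])

lemma smooth_on_diff:
  "open S \<Longrightarrow> smooth_on S f \<Longrightarrow> smooth_on S g \<Longrightarrow> smooth_on S (\<lambda>p. f p - g p)"
  using smooth_on_add[of S f "\<lambda>p. - g p"] smooth_on_minus[of S g] by simp

lemma smooth_on_scaleR:
  "open S \<Longrightarrow> smooth_on S f \<Longrightarrow> smooth_on S g \<Longrightarrow> smooth_on S (\<lambda>p. f p *\<^sub>R g p)"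
  unfolding smooth_on_def by (simp add: Ck_on_bilinear[OF _ bounded_bilinear_scaleR])

lemma smooth_on_mult:
  fixes f g :: "'a::real_normed_vector \<Rightarrow> 'b::real_normed_algebra"
  shows "open S \<Longrightarrow> smooth_on S f \<Longrightarrow> smooth_on S g \<Longrightarrow> smooth_on S (\<lambda>p. f p * g p)"
  unfolding smooth_on_def by (simp add: Ck_on_bilinear[OF _ bounded_bilinear_mult])

lemma smooth_on_power:
  fixes f :: "'a::real_normed_vector \<Rightarrow> 'b::real_normed_algebra_1"
  shows "open S \<Longrightarrow> smooth_on S f \<Longrightarrow> smooth_on S (\<lambda>p. f p ^ n)"
  by (induction n) (auto intro: smooth_on_const smooth_on_mult)

lemma smooth_on_sum:
  "open S \<Longrightarrow> (\<And>i. i \<in> I \<Longrightarrow> smooth_on S (f i)) \<Longrightarrow> smooth_on S (\<lambda>p. \<Sum>i\<in>I. f i p)"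
  unfolding smooth_on_def by (simp add: Ck_on_sum)

lemma smooth_on_Pair:
  assumes "open S" "smooth_on S f" "smooth_on S g"
  shows "smooth_on S (\<lambda>p. (f p, g p))"
proof -
  have "smooth_on S (\<lambda>p. (f p, 0) + (0, g p))"
    by (intro smooth_on_add smooth_on_linear_compose[where L = "\<lambda>x. (x, 0)"]
        smooth_on_linear_compose[where L = "\<lambda>x. (0, x)"] assms
        bounded_linear_Pair bounded_linear_ident bounded_linear_zero)
  then show ?thesis by simp
qed

lemma smooth_on_compose:
  fixes f :: "'b::euclidean_space \<Rightarrow> 'c::real_normed_vector"
  assumes "open S" "open T" "smooth_on T f" "smooth_on S g" "g ` S \<subseteq> T"
  shows "smooth_on S (\<lambda>p. f (g p))"
  using assms Ck_on_compose unfolding smooth_on_def by blast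

lemmas smooth_intros = smooth_on_const smooth_on_ident smooth_on_fst smooth_on_snd smooth_on_of_real
  smooth_on_Re smooth_on_Im smooth_on_cnj smooth_on_add smooth_on_minus smooth_on_diff
  smooth_on_scaleR smooth_on_mult smooth_on_power smooth_on_sum smooth_on_Pair

lemma smooth_on_has_derivative:
  assumes "smooth_on S f" "p \<in> S"
  shows "(f has_derivative frechet_derivative f (at p)) (at p)"
  using assms Ck_on_Suc_derivative unfolding smooth_on_def by blast

lemma smooth_on_frechet_derivative:
  assumes "smooth_on S f"
  shows "smooth_on S (\<lambda>p. frechet_derivative f (at p) v)"
  unfolding smooth_on_def
proof
  fix k
  have "Ck_on (Suc k) S f" using assms by (simp add: smooth_on_def)
  then show "Ck_on k S (\<lambda>p. frechet_derivative f (at p) v)" by simp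
qed

lemma smooth_on_imp_continuous_on: "smooth_on S f \<Longrightarrow> continuous_on S f"
  unfolding smooth_on_def by (metis Ck_on.simps(1))

section \<open>The smooth inverse and implicit function theorems\<close>

text \<open>Because \<open>g x = 0\<close>, the error splits into the error of \<open>g\<close>
  times \<open>h y\<close> and \<open>g' (y - x)\<close> times \<open>h y - h x\<close>, so
  continuity of \<open>h\<close> suffices. In the next lemma \<open>h\<close> is an inverse whose
  differentiability is still open.\<close>

lemma has_derivative_scaleR_vanishing:
  fixes g :: "'a::real_normed_vector \<Rightarrow> real" and h :: "'a \<Rightarrow> 'b::real_normed_vector"
  assumes g: "(g has_derivative g') (at x)" and "g x = 0" and h: "isCont h x"
  shows "((\<lambda>y. g y *\<^sub>R h y) has_derivative (\<lambda>v. g' v *\<^sub>R h x)) (at x)"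
proof -
  have bl: "bounded_linear g'" using g by (rule has_derivative_bounded_linear)
  obtain K where K: "\<And>v. norm (g' v) \<le> norm v * K"
    using bounded_linear.bounded[OF bl] by blast
  have lim: "((\<lambda>y. norm (g y - g x - g' (y - x)) / norm (y - x)) \<longlongrightarrow> 0) (at x)"
    using g by (simp add: has_derivative_iff_norm)
  have h': "(h \<longlongrightarrow> h x) (at x)" using h by (simp add: isCont_def)
  have "((\<lambda>y. norm (g y - g x - g' (y - x)) / norm (y - x) * norm (h y) + K * norm (h y - h x))
      \<longlongrightarrow> 0 * norm (h x) + K * norm (h x - h x)) (at x)"
    by (intro tendsto_intros lim h')
  then have lim0: "((\<lambda>y. norm (g y - g x - g' (y - x)) / norm (y - x) * norm (h y)
      + K * norm (h y - h x)) \<longlongrightarrow> 0) (at x)" by simp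
  show ?thesis unfolding has_derivative_iff_norm
  proof (intro conjI)
    show "bounded_linear (\<lambda>v. g' v *\<^sub>R h x)"
      by (rule bounded_linear_compose[OF bounded_linear_scaleR_left bl])
    show "((\<lambda>y. norm (g y *\<^sub>R h y - g x *\<^sub>R h x - g' (y - x) *\<^sub>R h x) / norm (y - x)) \<longlongrightarrow> 0) (at x)"
    proof (rule Lim_null_comparison[OF _ lim0], rule eventuallyI)
      fix y
      show "norm (norm (g y *\<^sub>R h y - g x *\<^sub>R h x - g' (y - x) *\<^sub>R h x) / norm (y - x))
        \<le> norm (g y - g x - g' (y - x)) / norm (y - x) * norm (h y) + K * norm (h y - h x)"
      proof (cases "y = x")
        case False
        have "g y *\<^sub>R h y - g x *\<^sub>R h x - g' (y - x) *\<^sub>R h x =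
            (g y - g x - g' (y - x)) *\<^sub>R h y + g' (y - x) *\<^sub>R (h y - h x)"
          by (simp add: assms(2) algebra_simps)
        then have "norm (g y *\<^sub>R h y - g x *\<^sub>R h x - g' (y - x) *\<^sub>R h x) \<le>
            norm (g y - g x - g' (y - x)) * norm (h y) + norm (g' (y - x)) * norm (h y - h x)"
          by (metis norm_scaleR norm_triangle_ineq real_norm_def)
        also have "\<dots> \<le> norm (g y - g x - g' (y - x)) * norm (h y) + norm (y - x) * K * norm (h y - h x)"
          using K by (intro add_left_mono mult_right_mono) auto
        finally show ?thesis using False by (simp add: field_simps)
      qed (use assms(2) in simp)
    qed
  qed
qed

text \<open>Everything rests on the resolvent identity \<open>diffB\<close>, that is, B y - B y0 = -
  B y (A y - A y0) B y0. It gives first continuity of \<open>B\<close>, then the derivative - B A'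
  B. This involves \<open>B\<close> only at the regularity already reached, so the induction on
  \<open>k\<close> closes.\<close>

lemma Ck_on_inverse_operator:
  fixes A B :: "'a::euclidean_space \<Rightarrow> 'b::euclidean_space \<Rightarrow> 'b"
  assumes "open V"
    and A: "\<And>b. Ck_on k V (\<lambda>y. A y b)" and lA: "\<And>y. y \<in> V \<Longrightarrow> linear (A y)"
    and lB: "\<And>y. y \<in> V \<Longrightarrow> linear (B y)"
    and AB: "\<And>y b. y \<in> V \<Longrightarrow> A y (B y b) = b" and BA: "\<And>y b. y \<in> V \<Longrightarrow> B y (A y b) = b"
  shows "Ck_on k V (\<lambda>y. B y b)"
proof -
  have diffB: "B y b - B y0 b = - B y (A y (B y0 b) - A y0 (B y0 b))" if "y \<in> V" "y0 \<in> V" for y y0 b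
    using that by (simp add: linear_diff[OF lB] AB BA)
  have contB: "continuous_on V (\<lambda>y. B y b)" if cA: "\<And>b. continuous_on V (\<lambda>y. A y b)" for b
    unfolding continuous_on_eq_continuous_at[OF \<open>open V\<close>]
  proof
    fix y0 assume y0: "y0 \<in> V"
    have nhd: "\<forall>\<^sub>F y in at y0. y \<in> V" using \<open>open V\<close> y0 by (simp add: eventually_at_in_open')
    have tA: "((\<lambda>y. A y b) \<longlongrightarrow> A y0 b) (at y0)" for b
      using cA[of b] y0 \<open>open V\<close> by (simp add: continuous_on_eq_continuous_at isCont_def)
    obtain K where K: "K > 0" "\<And>x. norm (B y0 x) \<le> norm x * K"
      using lB[OF y0] linear_conv_bounded_linear bounded_linear.pos_bounded by metis
    define M where "M y = (\<Sum>b\<in>Basis. norm (A y b - A y0 b))" for y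
    have "(M \<longlongrightarrow> (\<Sum>b\<in>(Basis::'b set). norm (A y0 b - A y0 b))) (at y0)"
      unfolding M_def by (intro tendsto_intros tA)
    then have "(M \<longlongrightarrow> 0) (at y0)" by simp
    \<comment> \<open>With this threshold \<open>M y * norm ?u * K\<close> is at most half of
      \<open>norm ?u\<close> and can be absorbed, which bounds \<open>B y\<close> uniformly near
      \<open>y0\<close>.\<close>
    then have M: "\<forall>\<^sub>F y in at y0. M y < 1 / (2 * K)"
      using K(1) by (intro order_tendstoD) auto
    have bound: "norm (B y c) \<le> 2 * K * norm c" if "y \<in> V" "M y < 1 / (2 * K)" for y c
    proof -
      let ?u = "B y c"
      have Mu: "norm (A y ?u - A y0 ?u) \<le> M y * norm ?u"
      proof -
        have "A y ?u - A y0 ?u = (\<Sum>b\<in>Basis. (?u \<bullet> b) *\<^sub>R (A y b - A y0 b))"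
          unfolding linear_expand_Basis[OF lA[OF that(1)], of ?u]
            linear_expand_Basis[OF lA[OF y0], of ?u]
          by (simp add: sum_subtractf scaleR_diff_right)
        also have "norm \<dots> \<le> (\<Sum>b\<in>Basis. norm ?u * norm (A y b - A y0 b))"
          by (intro sum_norm_le) (auto intro!: mult_right_mono simp: Basis_le_norm)
        finally show ?thesis by (simp add: M_def sum_distrib_left mult.commute)
      qed
      have "norm ?u = norm (B y0 (A y0 ?u))" by (simp add: BA y0)
      also have "\<dots> \<le> norm (A y0 ?u) * K" by (rule K)
      also have "\<dots> \<le> (norm c + M y * norm ?u) * K"
      proof -
        have "A y0 ?u = c - (A y ?u - A y0 ?u)" using AB[OF that(1)] by simp
        then have "norm (A y0 ?u) \<le> norm c + norm (A y ?u - A y0 ?u)"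
          by (metis norm_triangle_ineq4)
        then show ?thesis using Mu K(1) by (intro mult_right_mono) auto
      qed
      also have "\<dots> \<le> norm c * K + norm ?u / 2"
      proof -
        have "M y * K \<le> 1 / 2" using that(2) K(1) by (simp add: field_simps)
        then have "(M y * K) * norm ?u \<le> 1 / 2 * norm ?u" by (rule mult_right_mono) simp
        then show ?thesis by (simp add: algebra_simps)
      qed
      finally show ?thesis by (simp add: algebra_simps)
    qed
    have "((\<lambda>y. B y b - B y0 b) \<longlongrightarrow> 0) (at y0)"
    proof (rule Lim_null_comparison)
      show "\<forall>\<^sub>F y in at y0. norm (B y b - B y0 b) \<le> 2 * K * norm (A y (B y0 b) - A y0 (B y0 b))"
        using nhd M
      proof eventually_elim
        case (elim y)
        then show ?case using bound[OF elim] diffB[of y y0 b] y0 by simp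
      qed
      have "((\<lambda>y. 2 * K * norm (A y (B y0 b) - A y0 (B y0 b))) \<longlongrightarrow>
          2 * K * norm (A y0 (B y0 b) - A y0 (B y0 b))) (at y0)"
        by (intro tendsto_intros tA)
      then show "((\<lambda>y. 2 * K * norm (A y (B y0 b) - A y0 (B y0 b))) \<longlongrightarrow> 0) (at y0)" by simp
    qed
    then show "isCont (\<lambda>y. B y b) y0" unfolding isCont_def by (simp add: LIM_zero_iff)
  qed
  show ?thesis using A
  proof (induction k arbitrary: b)
    case 0
    then show ?case using contB by simp
  next
    case (Suc k)
    have IH: "Ck_on k V (\<lambda>y. B y b)" for b
      using Suc Ck_on_Suc_lower[OF \<open>open V\<close>] by blast
    have contA: "continuous_on V (\<lambda>y. A y b)" for b
      using Ck_on_imp_continuous_on[OF \<open>open V\<close> Suc.prems] .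
    let ?DA = "\<lambda>y b v. frechet_derivative (\<lambda>y. A y b) (at y) v"
    show ?case
    proof (rule Ck_on_SucI[OF \<open>open V\<close>])
      fix y0 assume y0: "y0 \<in> V"
      let ?F = "\<lambda>y. A y (B y0 b)"
      have DF: "(?F has_derivative ?DA y0 (B y0 b)) (at y0)"
        using Ck_on_Suc_derivative[OF Suc.prems y0] .
      \<comment> \<open>The scalars are differentiable and vanish at \<open>y0\<close>; of the
        factors \<open>B y c\<close> only continuity is used.\<close>
      have exp: "B y b = B y0 b - (\<Sum>c\<in>Basis. ((?F y - ?F y0) \<bullet> c) *\<^sub>R B y c)" if "y \<in> V" for y
        using diffB[OF that y0, of b] linear_expand_Basis[OF lB[OF that], of "?F y - ?F y0"]
        by (simp add: algebra_simps)
      have prod: "((\<lambda>y. ((?F y - ?F y0) \<bullet> c) *\<^sub>R B y c) has_derivative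
          (\<lambda>v. (?DA y0 (B y0 b) v \<bullet> c) *\<^sub>R B y0 c)) (at y0)" for c
      proof (rule has_derivative_scaleR_vanishing)
        show "((\<lambda>y. (?F y - ?F y0) \<bullet> c) has_derivative (\<lambda>v. ?DA y0 (B y0 b) v \<bullet> c)) (at y0)"
          by (auto intro!: derivative_eq_intros DF)
        show "isCont (\<lambda>y. B y c) y0"
          using contB[OF contA] y0 \<open>open V\<close> by (simp add: continuous_on_eq_continuous_at)
      qed simp
      have "((\<lambda>y. B y0 b - (\<Sum>c\<in>Basis. ((?F y - ?F y0) \<bullet> c) *\<^sub>R B y c)) has_derivative
         (\<lambda>v. 0 - (\<Sum>c\<in>Basis. (?DA y0 (B y0 b) v \<bullet> c) *\<^sub>R B y0 c))) (at y0)"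
        by (intro has_derivative_diff has_derivative_const has_derivative_sum prod)
      then show "((\<lambda>y. B y b) has_derivative
         (\<lambda>v. - (\<Sum>c\<in>Basis. (?DA y0 (B y0 b) v \<bullet> c) *\<^sub>R B y0 c))) (at y0)"
        unfolding diff_0 by (rule has_derivative_transform_within_open[OF _ \<open>open V\<close> y0]) (rule exp[symmetric])
    next
      fix v
      \<comment> \<open>The vector \<open>B y b\<close> is frozen while \<open>A\<close> is
        differentiated. Expanding it leaves derivatives of the maps
        \<open>\<lambda>z. A z d\<close>, whose regularity is given.\<close>
      have eq: "?DA y (B y b) v = (\<Sum>d\<in>Basis. (B y b \<bullet> d) *\<^sub>R ?DA y d v)" if y: "y \<in> V" for y
      proof -
        have "((\<lambda>z. \<Sum>d\<in>Basis. (B y b \<bullet> d) *\<^sub>R A z d) has_derivative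
            (\<lambda>v. \<Sum>d\<in>Basis. (B y b \<bullet> d) *\<^sub>R ?DA y d v)) (at y)"
          by (intro has_derivative_sum has_derivative_scaleR_right Ck_on_Suc_derivative[OF Suc.prems y])
        then have "((\<lambda>z. A z (B y b)) has_derivative
            (\<lambda>v. \<Sum>d\<in>Basis. (B y b \<bullet> d) *\<^sub>R ?DA y d v)) (at y)"
          by (rule has_derivative_transform_within_open[OF _ \<open>open V\<close> y])
            (simp add: linear_expand_Basis[OF lA, symmetric])
        then show ?thesis by (rule frechet_derivative_at[THEN fun_cong, symmetric])
      qed
      have "Ck_on k V (\<lambda>y. - (\<Sum>c\<in>Basis. ((\<Sum>d\<in>Basis. (B y b \<bullet> d) *\<^sub>R ?DA y d v) \<bullet> c) *\<^sub>R B y c))"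
        using Suc.prems
        by (intro Ck_on_bounded_linear_compose[OF \<open>open V\<close> bounded_linear_minus[OF bounded_linear_ident]]
            Ck_on_inner_scaleR \<open>open V\<close> IH) auto
      then show "Ck_on k V (\<lambda>y. - (\<Sum>c\<in>Basis. (?DA y (B y b) v \<bullet> c) *\<^sub>R B y c))"
        by (subst Ck_on_cong[OF \<open>open V\<close>]) (simp_all only: eq)
    qed
  qed
qed


text \<open>The inverse function theorem for continuous derivatives gives \<open>g' y\<close> as the
  inverse of \<open>D (g y)\<close>. If \<open>g\<close> is of class \<open>k\<close>, then so is
  \<open>D (g y)\<close>, hence \<open>g' y\<close> by \<open>Ck_on_inverse_operator\<close>, and
  \<open>g\<close> is of class \<open>Suc k\<close>.\<close>

lemma smooth_inverse_function:
  fixes f :: "'a::euclidean_space \<Rightarrow> 'a"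
  assumes "open U" and f: "smooth_on U f" and x0: "x0 \<in> U"
    and inj: "inj (frechet_derivative f (at x0))"
  obtains U' V g where "open U'" "U' \<subseteq> U" "x0 \<in> U'" "open V" "f x0 \<in> V"
    "homeomorphism U' V f g" "smooth_on V g"
proof -
  define D where "D x = frechet_derivative f (at x)" for x
  have D: "(f has_derivative D x) (at x)" if "x \<in> U" for x
    using smooth_on_has_derivative[OF f that] by (simp add: D_def)
  have bl: "bounded_linear (D x)" if "x \<in> U" for x
    using D[OF that] by (rule has_derivative_bounded_linear)
  have F: "blinfun_apply (Blinfun (D x)) = D x" if "x \<in> U" for x
    using bl[OF that] by (rule bounded_linear_Blinfun_apply)
  have sD: "smooth_on U (\<lambda>x. D x b)" for b
    unfolding D_def by (rule smooth_on_frechet_derivative[OF f])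
  have contF: "continuous_on U (\<lambda>x. Blinfun (D x))"
  proof (rule continuous_on_blinfun_componentwise)
    fix b :: 'a
    show "continuous_on U (\<lambda>x. blinfun_apply (Blinfun (D x)) b)"
      using smooth_on_imp_continuous_on[OF sD] F by (simp cong: continuous_on_cong)
  qed
  obtain h where h: "linear h" "h \<circ> D x0 = id"
    using linear_injective_left_inverse[OF has_derivative_linear[OF D[OF x0]]] inj
    by (auto simp: D_def)
  have "bounded_linear h" using h(1) by (simp add: linear_conv_bounded_linear)
  then have inv: "Blinfun h o\<^sub>L Blinfun (D x0) = id_blinfun"
    using h(2) by (intro blinfun_eqI) (simp add: F[OF x0] bounded_linear_Blinfun_apply fun_eq_iff)
  obtain U' V g g' where U': "open U'" "U' \<subseteq> U" "x0 \<in> U'" and V: "open V" "f x0 \<in> V"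
    and hom: "homeomorphism U' V f g"
    and g: "\<And>y. y \<in> V \<Longrightarrow> (g has_derivative (g' y)) (at y)"
    and g': "\<And>y. y \<in> V \<Longrightarrow> g' y = Hilbert_Choice.inv (blinfun_apply (Blinfun (D (g y))))"
    and bij: "\<And>y. y \<in> V \<Longrightarrow> bij (blinfun_apply (Blinfun (D (g y))))"
    using inverse_function_theorem[OF \<open>open U\<close> _ contF x0 inv] D F by (metis (no_types, lifting))
  have gU: "g ` V \<subseteq> U" using hom U'(2) by (auto simp: homeomorphism_def)
  have g'D: "g' y = Hilbert_Choice.inv (D (g y))" and bijD: "bij (D (g y))" if "y \<in> V" for y
    using g'[OF that] bij[OF that] F[of "g y"] gU that by auto
  have "Ck_on k V g" for k
  proof (induction k)
    case 0
    then show ?case using hom by (simp add: homeomorphism_def)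
  next
    case (Suc k)
    show ?case
    proof (rule Ck_on_SucI[OF V(1) g])
      show "Ck_on k V (\<lambda>y. g' y b)" for b
      proof (rule Ck_on_inverse_operator[OF V(1), where A = "\<lambda>y. D (g y)"])
        show "Ck_on k V (\<lambda>y. D (g y) c)" for c
          using sD[of c] by (intro Ck_on_compose[OF V(1) \<open>open U\<close> _ Suc gU]) (simp add: smooth_on_def)
        show "linear (D (g y))" if "y \<in> V" for y
          using gU that by (intro has_derivative_linear[OF D]) auto
        show "linear (g' y)" if "y \<in> V" for y
          using g[OF that] by (rule has_derivative_linear)
        show "D (g y) (g' y c) = c" "g' y (D (g y) c) = c" if "y \<in> V" for y c
          using bijD[OF that] g'D[OF that]
          by (simp_all add: bij_is_surj surj_f_inv_f bij_is_inj)
      qed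
    qed
  qed
  then show thesis
    using that[OF U' V hom] by (simp add: smooth_on_def)
qed

text \<open>The map \<open>(p, \<eta>) \<mapsto> (p, G (p, \<eta>))\<close> is inverted, and
  \<theta> is the second component of the inverse on the slice with second coordinate 0.
  \<open>ker\<close> makes the derivative of this map injective, hence invertible.\<close>

lemma smooth_implicit_function:
  fixes G :: "'a::euclidean_space \<times> 'b::euclidean_space \<Rightarrow> 'b"
  assumes "open W" and G: "smooth_on W G" and ab: "(a, b) \<in> W" "G (a, b) = 0"
    and ker: "\<And>\<eta>. frechet_derivative G (at (a, b)) (0, \<eta>) = 0 \<Longrightarrow> \<eta> = 0"
  obtains V \<theta> where "open V" "a \<in> V" "\<theta> a = b" "smooth_on V \<theta>"
    "\<And>p. p \<in> V \<Longrightarrow> (p, \<theta> p) \<in> W \<and> G (p, \<theta> p) = 0"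
proof -
  define \<Phi> where "\<Phi> q = (fst q, G q)" for q
  let ?D = "\<lambda>v. (fst v, frechet_derivative G (at (a, b)) v)"
  have s\<Phi>: "smooth_on W \<Phi>"
    unfolding \<Phi>_def[abs_def] by (intro smooth_on_Pair smooth_on_fst smooth_on_ident G \<open>open W\<close>)
  have "(\<Phi> has_derivative ?D) (at (a, b))"
    unfolding \<Phi>_def[abs_def]
    by (intro has_derivative_Pair has_derivative_fst has_derivative_ident
        smooth_on_has_derivative[OF G ab(1)])
  then have D: "frechet_derivative \<Phi> (at (a, b)) = ?D" and lin: "linear ?D"
    using frechet_derivative_at has_derivative_linear by metis+
  have "inj ?D"
    unfolding linear_injective_0[OF lin] using ker by (auto simp: zero_prod_def)
  then obtain U' V' g where U': "U' \<subseteq> W" "(a, b) \<in> U'" and V': "open V'" "\<Phi> (a, b) \<in> V'"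
    and hom: "homeomorphism U' V' \<Phi> g" and g: "smooth_on V' g"
    using smooth_inverse_function[OF \<open>open W\<close> s\<Phi> ab(1)] D by metis
  define V where "V = (\<lambda>p. (p, 0)) -` V'"
  define \<theta> where "\<theta> p = snd (g (p, 0))" for p
  have "open V" unfolding V_def by (intro open_vimage V'(1) continuous_intros)
  have sub: "(\<lambda>p. (p, 0)) ` V \<subseteq> V'" by (auto simp: V_def)
  have gp: "(p, \<theta> p) \<in> W \<and> G (p, \<theta> p) = 0" if "p \<in> V" for p
  proof -
    have "(p, 0) \<in> V'" using that by (simp add: V_def)
    then have "g (p, 0) \<in> U'" "\<Phi> (g (p, 0)) = (p, 0)"
      using hom by (auto simp: homeomorphism_def)
    then show ?thesis using U' unfolding \<Phi>_def \<theta>_def by (cases "g (p, 0)") auto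
  qed
  show thesis
  proof (rule that[OF \<open>open V\<close>])
    show "a \<in> V" using V'(2) ab(2) by (simp add: V_def \<Phi>_def)
    have "g (\<Phi> (a, b)) = (a, b)" using hom U'(2) by (simp add: homeomorphism_def)
    then show "\<theta> a = b" by (simp add: \<Phi>_def \<theta>_def ab(2))
    show "smooth_on V \<theta>" unfolding \<theta>_def[abs_def]
      by (intro smooth_on_snd smooth_on_compose[OF \<open>open V\<close> V'(1) g _ sub] smooth_on_Pair
          smooth_on_ident smooth_on_const \<open>open V\<close>)
  qed (rule gp)
qed

section \<open>The order filtration\<close>

text \<open>Membership of \<open>f\<close> in the \<open>n\<close>-th power of the ideal generated by the two coordinates of \<open>\<pi>\<close>
  in the ring of smooth functions on \<open>U\<close>.\<close>

primrec vanishing :: "'a::real_normed_vector set \<Rightarrow> ('a \<Rightarrow> plane) \<Rightarrow> nat \<Rightarrow>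
    ('a \<Rightarrow> 'b::real_normed_vector) \<Rightarrow> bool" where
  "vanishing U \<pi> 0 f \<longleftrightarrow> smooth_on U f"
| "vanishing U \<pi> (Suc n) f \<longleftrightarrow> (\<exists>g h. vanishing U \<pi> n g \<and> vanishing U \<pi> n h \<and>
      (\<forall>p\<in>U. f p = fst (\<pi> p) *\<^sub>R g p + snd (\<pi> p) *\<^sub>R h p))"

lemma vanishing_SucI:
  assumes "vanishing U \<pi> n g" "vanishing U \<pi> n h"
    and "\<And>p. p \<in> U \<Longrightarrow> f p = fst (\<pi> p) *\<^sub>R g p + snd (\<pi> p) *\<^sub>R h p"
  shows "vanishing U \<pi> (Suc n) f"
  using assms by auto

lemma vanishing_SucE:
  assumes "vanishing U \<pi> (Suc n) f"
  obtains g h where "vanishing U \<pi> n g" "vanishing U \<pi> n h"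
    "\<And>p. p \<in> U \<Longrightarrow> f p = fst (\<pi> p) *\<^sub>R g p + snd (\<pi> p) *\<^sub>R h p"
  using assms by auto

context
  fixes U :: "'a::real_normed_vector set" and \<pi> :: "'a \<Rightarrow> plane"
  assumes U: "open U" and \<pi>: "smooth_on U \<pi>"
begin

lemma vanishing_cong:
  assumes "\<And>p. p \<in> U \<Longrightarrow> f p = g p"
  shows "vanishing U \<pi> n f \<longleftrightarrow> vanishing U \<pi> n g"
proof (cases n)
  case 0
  then show ?thesis using smooth_on_cong[OF U assms] by simp
qed (simp add: assms)

lemma vanishing_Suc_lower: "vanishing U \<pi> (Suc n) f \<Longrightarrow> vanishing U \<pi> n f"
proof (induction n arbitrary: f)
  case 0
  then obtain g h where gh: "smooth_on U g" "smooth_on U h"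
    "\<forall>p\<in>U. f p = fst (\<pi> p) *\<^sub>R g p + snd (\<pi> p) *\<^sub>R h p" by auto
  have "smooth_on U (\<lambda>p. fst (\<pi> p) *\<^sub>R g p + snd (\<pi> p) *\<^sub>R h p)"
    by (intro smooth_intros U \<pi> gh)
  moreover have "smooth_on U f \<longleftrightarrow> smooth_on U (\<lambda>p. fst (\<pi> p) *\<^sub>R g p + snd (\<pi> p) *\<^sub>R h p)"
    by (rule smooth_on_cong[OF U]) (use gh(3) in blast)
  ultimately show ?case by simp
next
  case (Suc n)
  then obtain g h where "vanishing U \<pi> (Suc n) g" "vanishing U \<pi> (Suc n) h"
    "\<forall>p\<in>U. f p = fst (\<pi> p) *\<^sub>R g p + snd (\<pi> p) *\<^sub>R h p"
    unfolding vanishing.simps(2)[of U \<pi> "Suc n"] by blast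
  then show ?case unfolding vanishing.simps(2)[of U \<pi> n f] using Suc.IH by blast
qed

lemma vanishing_mono: "vanishing U \<pi> n f \<Longrightarrow> m \<le> n \<Longrightarrow> vanishing U \<pi> m f"
  by (induction n) (auto simp: le_Suc_eq simp del: vanishing.simps dest: vanishing_Suc_lower)

lemma vanishing_smooth: "vanishing U \<pi> n f \<Longrightarrow> smooth_on U f"
  using vanishing_mono[of n f 0] by simp

lemma vanishing_linear_compose:
  assumes "bounded_linear L" "vanishing U \<pi> n f"
  shows "vanishing U \<pi> n (\<lambda>p. L (f p))"
  using assms(2)
proof (induction n arbitrary: f)
  case 0
  then show ?case using smooth_on_linear_compose[OF U assms(1)] by simp
next
  case (Suc n)
  then obtain g h where "vanishing U \<pi> n g" "vanishing U \<pi> n h"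
    "\<forall>p\<in>U. f p = fst (\<pi> p) *\<^sub>R g p + snd (\<pi> p) *\<^sub>R h p" by auto
  then show ?case using Suc.IH assms(1)
    by (intro vanishing_SucI[of _ _ _ "\<lambda>p. L (g p)" "\<lambda>p. L (h p)"]) (simp_all add: linear_simps)
qed

lemma vanishing_add:
  "vanishing U \<pi> n f \<Longrightarrow> vanishing U \<pi> n g \<Longrightarrow> vanishing U \<pi> n (\<lambda>p. f p + g p)"
proof (induction n arbitrary: f g)
  case 0
  then show ?case by (simp add: smooth_on_add[OF U])
next
  case (Suc n)
  obtain a b where ab: "vanishing U \<pi> n a" "vanishing U \<pi> n b"
    "\<forall>p\<in>U. f p = fst (\<pi> p) *\<^sub>R a p + snd (\<pi> p) *\<^sub>R b p" using Suc.prems(1) by auto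
  obtain c d where cd: "vanishing U \<pi> n c" "vanishing U \<pi> n d"
    "\<forall>p\<in>U. g p = fst (\<pi> p) *\<^sub>R c p + snd (\<pi> p) *\<^sub>R d p" using Suc.prems(2) by auto
  show ?case unfolding vanishing.simps
    by (rule exI[of _ "\<lambda>p. a p + c p"], rule exI[of _ "\<lambda>p. b p + d p"])
      (use ab cd Suc.IH in \<open>auto simp: algebra_simps\<close>)
qed

lemma vanishing_zero: "vanishing U \<pi> n (\<lambda>p. 0)"
proof (induction n)
  case (Suc n)
  then show ?case by (auto intro!: exI[of _ "\<lambda>p. 0"])
qed (simp add: smooth_on_const)

lemma vanishing_sum:
  "(\<And>i. i \<in> I \<Longrightarrow> vanishing U \<pi> n (f i)) \<Longrightarrow> vanishing U \<pi> n (\<lambda>p. \<Sum>i\<in>I. f i p)"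
  by (induction I rule: infinite_finite_induct) (simp_all add: vanishing_zero vanishing_add)

lemma vanishing_bilinear:
  assumes "bounded_bilinear B" "vanishing U \<pi> m f" "vanishing U \<pi> n g"
  shows "vanishing U \<pi> (m + n) (\<lambda>p. B (f p) (g p))"
  using assms(2)
proof (induction m arbitrary: f)
  case 0
  interpret bounded_bilinear B by fact
  show ?case unfolding add_0 using assms(3)
  proof (induction n arbitrary: g)
    case 0
    then show ?case using \<open>vanishing U \<pi> 0 f\<close> Ck_on_bilinear[OF U assms(1)]
      by (simp add: smooth_on_def)
  next
    case (Suc n)
    then obtain c d where "vanishing U \<pi> n c" "vanishing U \<pi> n d"
      "\<forall>p\<in>U. g p = fst (\<pi> p) *\<^sub>R c p + snd (\<pi> p) *\<^sub>R d p" by auto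
    then show ?case using Suc.IH
      by (intro vanishing_SucI[of _ _ _ "\<lambda>p. B (f p) (c p)" "\<lambda>p. B (f p) (d p)"])
        (simp_all add: add_right scaleR_right)
  qed
next
  case (Suc m)
  interpret bounded_bilinear B by fact
  obtain a b where "vanishing U \<pi> m a" "vanishing U \<pi> m b"
    "\<forall>p\<in>U. f p = fst (\<pi> p) *\<^sub>R a p + snd (\<pi> p) *\<^sub>R b p" using Suc.prems by auto
  then show ?case using Suc.IH unfolding add_Suc
    by (intro vanishing_SucI[of _ _ _ "\<lambda>p. B (a p) (g p)" "\<lambda>p. B (b p) (g p)"])
      (simp_all add: add_left scaleR_left)
qed

lemmas vanishing_scaleR = vanishing_bilinear[OF bounded_bilinear_scaleR]
lemmas vanishing_mult = vanishing_bilinear[OF bounded_bilinear_mult]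

lemma vanishing_smooth_mult:
  fixes f g :: "'a \<Rightarrow> 'b::real_normed_algebra"
  shows "smooth_on U f \<Longrightarrow> vanishing U \<pi> n g \<Longrightarrow> vanishing U \<pi> n (\<lambda>p. f p * g p)"
  using vanishing_mult[of 0 f n g] by simp

lemma vanishing_power:
  fixes f :: "'a \<Rightarrow> 'b::real_normed_algebra_1"
  assumes "vanishing U \<pi> n f"
  shows "vanishing U \<pi> (k * n) (\<lambda>p. f p ^ k)"
proof (induction k)
  case (Suc k)
  then show ?case using vanishing_mult[OF assms Suc] by (simp add: add.commute)
qed (simp add: smooth_on_const)

lemma vanishing_Suc_eq_0: "vanishing U \<pi> (Suc n) f \<Longrightarrow> p \<in> U \<Longrightarrow> \<pi> p = 0 \<Longrightarrow> f p = 0"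
  by auto

lemma vanishing_fst: "vanishing U \<pi> 1 (\<lambda>p. fst (\<pi> p))"
  unfolding One_nat_def vanishing.simps
  by (rule exI[of _ "\<lambda>p. 1"], rule exI[of _ "\<lambda>p. 0"]) (simp add: smooth_on_const)

lemma vanishing_snd: "vanishing U \<pi> 1 (\<lambda>p. snd (\<pi> p))"
  unfolding One_nat_def vanishing.simps
  by (rule exI[of _ "\<lambda>p. 0"], rule exI[of _ "\<lambda>p. 1"]) (simp add: smooth_on_const)

text \<open>Each generator for \<pi>' lies in the ideal for \<pi>, so the factors can be exchanged
  one by one without loss of order.\<close>

lemma vanishing_change_coordinates:
  assumes "vanishing U \<pi>' n f"
    and "vanishing U \<pi> 1 (\<lambda>p. fst (\<pi>' p))" "vanishing U \<pi> 1 (\<lambda>p. snd (\<pi>' p))"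
  shows "vanishing U \<pi> n f"
  using assms(1)
proof (induction n arbitrary: f)
  case (Suc n)
  then obtain g h where gh: "vanishing U \<pi> n g" "vanishing U \<pi> n h"
    "\<forall>p\<in>U. f p = fst (\<pi>' p) *\<^sub>R g p + snd (\<pi>' p) *\<^sub>R h p" by auto
  have "vanishing U \<pi> (1 + n) (\<lambda>p. fst (\<pi>' p) *\<^sub>R g p + snd (\<pi>' p) *\<^sub>R h p)"
    by (intro vanishing_add vanishing_scaleR assms gh)
  then show ?case using gh(3) vanishing_cong[of f] by simp
qed simp

lemma vanishing_expansion:
  fixes f :: "'a \<Rightarrow> real"
  assumes "vanishing U \<pi> n f"
  shows "\<exists>G. (\<forall>i. smooth_on U (G i)) \<and>
    (\<forall>p\<in>U. f p = (\<Sum>i\<le>n. G i p * fst (\<pi> p) ^ i * snd (\<pi> p) ^ (n - i)))"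
  using assms
proof (induction n arbitrary: f)
  case 0
  then show ?case by (intro exI[of _ "\<lambda>i. f"]) simp
next
  case (Suc n)
  then obtain g h where gh: "vanishing U \<pi> n g" "vanishing U \<pi> n h"
    "\<forall>p\<in>U. f p = fst (\<pi> p) * g p + snd (\<pi> p) * h p" by auto
  obtain A where A: "\<And>i. smooth_on U (A i)"
    "\<And>p. p \<in> U \<Longrightarrow> g p = (\<Sum>i\<le>n. A i p * fst (\<pi> p) ^ i * snd (\<pi> p) ^ (n - i))"
    using Suc.IH[OF gh(1)] by blast
  obtain B where B: "\<And>i. smooth_on U (B i)"
    "\<And>p. p \<in> U \<Longrightarrow> h p = (\<Sum>i\<le>n. B i p * fst (\<pi> p) ^ i * snd (\<pi> p) ^ (n - i))"
    using Suc.IH[OF gh(2)] by blast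
  \<comment> \<open>Exponent \<open>i\<close> of the first coordinate arises from exponent
    \<open>i - 1\<close> in \<open>g\<close> and from exponent \<open>i\<close> in \<open>h\<close>;
    the guards treat the ends \<open>i = 0\<close> and \<open>i = Suc n\<close>, where one source is
    missing.\<close>
  define C where "C i p = (if i = 0 then 0 else A (i - 1) p) + (if i \<le> n then B i p else 0)" for i p
  have "smooth_on U (C i)" for i
    unfolding C_def[abs_def] using A(1) B(1) by (cases "i = 0"; cases "i \<le> n") (auto intro!: smooth_intros U)
  moreover have "f p = (\<Sum>i\<le>Suc n. C i p * fst (\<pi> p) ^ i * snd (\<pi> p) ^ (Suc n - i))" if "p \<in> U" for p
  proof -
    let ?x = "fst (\<pi> p)" and ?y = "snd (\<pi> p)"
    have "(\<Sum>i\<le>Suc n. C i p * ?x ^ i * ?y ^ (Suc n - i)) =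
        (\<Sum>i\<le>Suc n. (if i = 0 then 0 else A (i - 1) p) * ?x ^ i * ?y ^ (Suc n - i)) +
        (\<Sum>i\<le>Suc n. (if i \<le> n then B i p else 0) * ?x ^ i * ?y ^ (Suc n - i))"
      by (simp add: C_def distrib_right sum.distrib del: sum.atMost_Suc)
    also have "(\<Sum>i\<le>Suc n. (if i = 0 then 0 else A (i - 1) p) * ?x ^ i * ?y ^ (Suc n - i)) = ?x * g p"
      by (simp add: sum.atMost_Suc_shift A(2)[OF that] sum_distrib_left mult_ac del: sum.atMost_Suc)
    also have "(\<Sum>i\<le>Suc n. (if i \<le> n then B i p else 0) * ?x ^ i * ?y ^ (Suc n - i)) = ?y * h p"
      by (simp add: B(2)[OF that] sum_distrib_left mult_ac Suc_diff_le)
    finally show ?thesis using gh(3) that by simp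
  qed
  ultimately show ?case by blast
qed

text \<open>In the Leibniz rule a factor is lost only where the derivative hits a coordinate of
  \<pi>.\<close>

lemma vanishing_frechet_derivative:
  assumes "vanishing U \<pi> (Suc n) f"
  shows "vanishing U \<pi> n (\<lambda>p. frechet_derivative f (at p) v)"
  using assms
proof (induction n arbitrary: f)
  case 0
  then show ?case using vanishing_smooth smooth_on_frechet_derivative by (metis vanishing.simps(1))
next
  case (Suc n)
  then obtain g h where gh: "vanishing U \<pi> (Suc n) g" "vanishing U \<pi> (Suc n) h"
    "\<forall>p\<in>U. f p = fst (\<pi> p) *\<^sub>R g p + snd (\<pi> p) *\<^sub>R h p"
    unfolding vanishing.simps(2)[of U \<pi> "Suc n"] by blast
  let ?D = "\<lambda>f p. frechet_derivative f (at p) v"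
  have sg: "smooth_on U g" "smooth_on U h" using gh vanishing_smooth by blast+
  have eq: "?D f p = (fst (\<pi> p) *\<^sub>R ?D g p + fst (?D \<pi> p) *\<^sub>R g p)
      + (snd (\<pi> p) *\<^sub>R ?D h p + snd (?D \<pi> p) *\<^sub>R h p)" if "p \<in> U" for p
  proof -
    have "((\<lambda>p. fst (\<pi> p) *\<^sub>R g p + snd (\<pi> p) *\<^sub>R h p) has_derivative
      (\<lambda>v. (fst (\<pi> p) *\<^sub>R frechet_derivative g (at p) v + fst (frechet_derivative \<pi> (at p) v) *\<^sub>R g p)
      + (snd (\<pi> p) *\<^sub>R frechet_derivative h (at p) v + snd (frechet_derivative \<pi> (at p) v) *\<^sub>R h p))) (at p)"
      by (intro has_derivative_add has_derivative_scaleR has_derivative_fst has_derivative_snd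
          smooth_on_has_derivative[OF _ that] sg \<pi>)
    then have "(f has_derivative
      (\<lambda>v. (fst (\<pi> p) *\<^sub>R frechet_derivative g (at p) v + fst (frechet_derivative \<pi> (at p) v) *\<^sub>R g p)
      + (snd (\<pi> p) *\<^sub>R frechet_derivative h (at p) v + snd (frechet_derivative \<pi> (at p) v) *\<^sub>R h p))) (at p)"
      by (rule has_derivative_transform_within_open[OF _ U that]) (use gh(3) in simp)
    then show ?thesis by (rule frechet_derivative_at[THEN fun_cong, symmetric])
  qed
  have "vanishing U \<pi> (Suc n) (\<lambda>p. (fst (\<pi> p) *\<^sub>R ?D g p + fst (?D \<pi> p) *\<^sub>R g p)
      + (snd (\<pi> p) *\<^sub>R ?D h p + snd (?D \<pi> p) *\<^sub>R h p))"
  proof (intro vanishing_add)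
    show "vanishing U \<pi> (Suc n) (\<lambda>p. fst (\<pi> p) *\<^sub>R ?D g p)" "vanishing U \<pi> (Suc n) (\<lambda>p. snd (\<pi> p) *\<^sub>R ?D h p)"
      using vanishing_scaleR[OF vanishing_fst Suc.IH[OF gh(1)]]
        vanishing_scaleR[OF vanishing_snd Suc.IH[OF gh(2)]] by simp_all
    have "smooth_on U (\<lambda>p. fst (?D \<pi> p))" "smooth_on U (\<lambda>p. snd (?D \<pi> p))"
      by (intro smooth_on_fst smooth_on_snd smooth_on_frechet_derivative U \<pi>)+
    then show "vanishing U \<pi> (Suc n) (\<lambda>p. fst (?D \<pi> p) *\<^sub>R g p)"
      "vanishing U \<pi> (Suc n) (\<lambda>p. snd (?D \<pi> p) *\<^sub>R h p)"
      using vanishing_scaleR[of 0 "\<lambda>p. fst (?D \<pi> p)" "Suc n" g] gh(1)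
        vanishing_scaleR[of 0 "\<lambda>p. snd (?D \<pi> p)" "Suc n" h] gh(2)
      unfolding vanishing.simps(1) add_0 by blast+
  qed
  then show ?case by (subst vanishing_cong[OF eq])
qed

end

lemma vanishing_pullback:
  fixes U :: "'a::euclidean_space set" and \<phi> :: "'c::euclidean_space \<Rightarrow> 'a"
  assumes "open S" "open U" "smooth_on S \<phi>" "\<phi> ` S \<subseteq> U" "vanishing U \<pi> n f"
  shows "vanishing S (\<lambda>p. \<pi> (\<phi> p)) n (\<lambda>p. f (\<phi> p))"
  using assms(5)
proof (induction n arbitrary: f)
  case 0
  then show ?case using smooth_on_compose[OF assms(1,2) _ assms(3,4)] by simp
next
  case (Suc n)
  then obtain g h where "vanishing U \<pi> n g" "vanishing U \<pi> n h"
    "\<forall>p\<in>U. f p = fst (\<pi> p) *\<^sub>R g p + snd (\<pi> p) *\<^sub>R h p" by auto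
  then show ?case using Suc.IH[of g] Suc.IH[of h] assms(4)
    by (intro vanishing_SucI[of _ _ _ "\<lambda>p. g (\<phi> p)" "\<lambda>p. h (\<phi> p)"]) auto
qed

section \<open>Hadamard's lemma\<close>

text \<open>Differentiation under the integral sign. Each derivative of
  \<open>f (t *\<^sub>R p)\<close> in \<open>p\<close> brings out one more factor \<open>t\<close>,
  so the induction has to run over all \<open>m\<close>.\<close>

lemma Ck_on_radial_integral:
  fixes f :: "'a::euclidean_space \<Rightarrow> 'b::euclidean_space"
  assumes "Ck_on k (ball 0 r) f"
  shows "Ck_on k (ball 0 r) (\<lambda>p. integral (cbox 0 1) (\<lambda>t::real. t ^ m *\<^sub>R f (t *\<^sub>R p)))"
  using assms
proof (induction k arbitrary: f m)
  have scale: "t *\<^sub>R p \<in> ball 0 r" if "p \<in> ball 0 r" "t \<in> cbox 0 1" for p :: 'a and t :: real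
  proof -
    have "norm (t *\<^sub>R p) \<le> 1 * norm p"
      using that(2) unfolding norm_scaleR by (intro mult_right_mono) auto
    then show ?thesis using that(1) by simp
  qed
  have cont: "continuous_on (ball 0 r \<times> cbox 0 1) (\<lambda>(p, t::real). t ^ m *\<^sub>R h (t *\<^sub>R p))"
    if "continuous_on (ball 0 r) h" for h :: "'a \<Rightarrow> 'c::real_normed_vector" and m
    unfolding case_prod_unfold
    by (intro continuous_intros continuous_on_compose2[OF that]) (auto intro: scale)
  {
    case 0
    then show ?case using integral_continuous_on_param[OF cont] by simp
  next
    case (Suc k)
    let ?B = "\<lambda>p t::real. t ^ Suc m *\<^sub>R Blinfun (frechet_derivative f (at (t *\<^sub>R p)))"
    have Df: "(f has_derivative frechet_derivative f (at q)) (at q)" if "q \<in> ball 0 r" for q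
      using Ck_on_Suc_derivative[OF Suc.prems that] .
    have app: "blinfun_apply (Blinfun (frechet_derivative f (at q))) = frechet_derivative f (at q)"
      if "q \<in> ball 0 r" for q
      by (rule bounded_linear_Blinfun_apply[OF has_derivative_bounded_linear[OF Df[OF that]]])
    have "continuous_on (ball 0 r) (\<lambda>q. frechet_derivative f (at q) b)" for b
      using Suc.prems by (intro Ck_on_imp_continuous_on[of _ k]) auto
    then have cB: "continuous_on (ball 0 r) (\<lambda>q. Blinfun (frechet_derivative f (at q)))"
    proof (intro continuous_on_blinfun_componentwise)
      fix b :: 'a assume "\<And>b. continuous_on (ball 0 r) (\<lambda>q. frechet_derivative f (at q) b)"
      then show "continuous_on (ball 0 r) (\<lambda>q. blinfun_apply (Blinfun (frechet_derivative f (at q))) b)"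
        by (subst continuous_on_cong[OF refl fun_cong[OF app]])
    qed
    have cf: "continuous_on (ball 0 r) f"
      using Suc.prems by (rule Ck_on_imp_continuous_on[OF open_ball])
    have slice: "(\<lambda>t::real. t ^ m *\<^sub>R h (t *\<^sub>R p)) integrable_on cbox 0 1"
      if "continuous_on (ball 0 r) h" "p \<in> ball 0 r" for h :: "'a \<Rightarrow> 'c::banach" and p m
      by (intro integrable_continuous continuous_intros continuous_on_compose2[OF that(1)])
        (use scale[OF that(2)] in auto)
    have D: "((\<lambda>p. integral (cbox 0 1) (\<lambda>t::real. t ^ m *\<^sub>R f (t *\<^sub>R p))) has_derivative
        blinfun_apply (integral (cbox 0 1) (?B p))) (at p)" if p: "p \<in> ball 0 r" for p
    proof -
      have "((\<lambda>p. integral (cbox 0 1) (\<lambda>t::real. t ^ m *\<^sub>R f (t *\<^sub>R p))) has_derivative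
        blinfun_apply (integral (cbox 0 1) (?B p))) (at p within ball 0 r)"
      proof (rule leibniz_rule[OF _ _ _ p convex_ball])
        fix q and t :: real assume q: "q \<in> ball (0::'a) r" and t: "t \<in> cbox 0 1"
        have "((\<lambda>q. t *\<^sub>R q) has_derivative (\<lambda>v. t *\<^sub>R v)) (at q)"
          by (intro has_derivative_scaleR_right has_derivative_ident)
        from diff_chain_at[OF this Df[OF scale[OF q t]]]
        have "((\<lambda>q. t ^ m *\<^sub>R f (t *\<^sub>R q)) has_derivative
            (\<lambda>v. t ^ m *\<^sub>R frechet_derivative f (at (t *\<^sub>R q)) (t *\<^sub>R v))) (at q)"
          by (intro has_derivative_scaleR_right) (simp add: o_def)
        moreover have "(\<lambda>v. t ^ m *\<^sub>R frechet_derivative f (at (t *\<^sub>R q)) (t *\<^sub>R v)) = blinfun_apply (?B q t)"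
          using has_derivative_linear[OF Df[OF scale[OF q t]]]
          by (simp add: fun_eq_iff app[OF scale[OF q t]] blinfun.scaleR_left linear_scale)
        ultimately show "((\<lambda>q. t ^ m *\<^sub>R f (t *\<^sub>R q)) has_derivative blinfun_apply (?B q t)) (at q within ball 0 r)"
          by (simp add: has_derivative_at_withinI)
      qed (rule slice[OF cf] cont[OF cB]; assumption?)+
      then show ?thesis by (simp only: at_within_open[OF p open_ball])
    qed
    show ?case
    proof (rule Ck_on_SucI[OF open_ball D])
      fix v
      have "Ck_on k (ball 0 r) (\<lambda>p. integral (cbox 0 1)
          (\<lambda>t::real. t ^ Suc m *\<^sub>R frechet_derivative f (at (t *\<^sub>R p)) v))"
        by (rule Suc.IH) (use Suc.prems in simp)
      moreover have "blinfun_apply (integral (cbox 0 1) (?B p)) v = integral (cbox 0 1)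
          (\<lambda>t::real. t ^ Suc m *\<^sub>R frechet_derivative f (at (t *\<^sub>R p)) v)" if "p \<in> ball 0 r" for p
        unfolding blinfun_apply_integral[OF slice[OF cB that]]
        by (rule Henstock_Kurzweil_Integration.integral_cong)
          (simp only: blinfun.scaleR_left app[OF scale[OF that]])
      ultimately show "Ck_on k (ball 0 r) (\<lambda>p. blinfun_apply (integral (cbox 0 1) (?B p)) v)"
        by (subst Ck_on_cong[OF open_ball])
    qed
  }
qed

text \<open>The derivative is integrated along the segment from 0 to \<open>p\<close> and expanded
  in the two basis vectors; the quotients are then radial integrals of partial derivatives.\<close>

lemma hadamard:
  fixes f :: "plane \<Rightarrow> 'b::euclidean_space"
  assumes f: "smooth_on (ball 0 r) f"
  shows "vanishing (ball 0 r) (\<lambda>p. p) 1 (\<lambda>p. f p - f 0)"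
proof -
  \<comment> \<open>The factor \<open>t ^ 0\<close> gives the integrand the form of
    \<open>Ck_on_radial_integral\<close> with \<open>m = 0\<close>.\<close>
  define g where "g b p = integral (cbox 0 1) (\<lambda>t::real. t ^ 0 *\<^sub>R frechet_derivative f (at (t *\<^sub>R p)) b)"
    for b p
  have sg: "smooth_on (ball 0 r) (g b)" for b
    using smooth_on_frechet_derivative[OF f, of b] Ck_on_radial_integral[of _ r _ 0]
    unfolding smooth_on_def g_def[abs_def] by blast
  have "f p - f 0 = fst p *\<^sub>R g (1, 0) p + snd p *\<^sub>R g (0, 1) p" if p: "p \<in> ball 0 r" for p
  proof -
    let ?D = "\<lambda>t. frechet_derivative f (at (t *\<^sub>R p))"
    have scale: "t *\<^sub>R p \<in> ball 0 r" if "t \<in> {0..1}" for t :: real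
    proof -
      have "norm (t *\<^sub>R p) \<le> 1 * norm p"
        using that unfolding norm_scaleR by (intro mult_right_mono) auto
      then show ?thesis using p by simp
    qed
    have cont: "continuous_on (cbox 0 1) (\<lambda>t. ?D t b)" for b
      by (intro continuous_on_compose2[OF smooth_on_imp_continuous_on[OF
              smooth_on_frechet_derivative[OF f, of b]]] continuous_intros) (use scale in auto)
    have "((\<lambda>t. ?D t p) has_integral (f (1 *\<^sub>R p) - f (0 *\<^sub>R p))) {0..1}"
    proof (rule fundamental_theorem_of_calculus)
      fix t :: real assume t: "t \<in> {0..1}"
      have "((\<lambda>t. t *\<^sub>R p) has_derivative (\<lambda>h. h *\<^sub>R p)) (at t)"
        by (intro has_derivative_scaleR_left has_derivative_ident)
      from diff_chain_at[OF this smooth_on_has_derivative[OF f scale[OF t]]]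
      have "((\<lambda>t. f (t *\<^sub>R p)) has_derivative (\<lambda>h. ?D t (h *\<^sub>R p))) (at t)" by (simp add: o_def)
      moreover have "?D t (h *\<^sub>R p) = h *\<^sub>R ?D t p" for h
        using has_derivative_linear[OF smooth_on_has_derivative[OF f scale[OF t]]] by (simp add: linear_scale)
      ultimately show "((\<lambda>t. f (t *\<^sub>R p)) has_vector_derivative ?D t p) (at t within {0..1})"
        by (simp add: has_vector_derivative_def has_derivative_at_withinI)
    qed simp
    then have "f p - f 0 = integral (cbox 0 1) (\<lambda>t. ?D t p)" by (simp add: integral_unique)
    also have "\<dots> = integral (cbox 0 1) (\<lambda>t. fst p *\<^sub>R ?D t (1, 0) + snd p *\<^sub>R ?D t (0, 1))"
    proof (rule Henstock_Kurzweil_Integration.integral_cong)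
      fix t :: real assume "t \<in> cbox 0 1"
      then have lin: "linear (?D t)"
        using has_derivative_linear[OF smooth_on_has_derivative[OF f scale]] by simp
      have "?D t p = ?D t (fst p *\<^sub>R (1, 0) + snd p *\<^sub>R (0, 1))" by simp
      then show "?D t p = fst p *\<^sub>R ?D t (1, 0) + snd p *\<^sub>R ?D t (0, 1)"
        by (simp only: linear_add[OF lin] linear_scale[OF lin])
    qed
    also have "\<dots> = fst p *\<^sub>R g (1, 0) p + snd p *\<^sub>R g (0, 1) p"
      using integrable_continuous[OF cont] unfolding g_def
      by (simp add: Henstock_Kurzweil_Integration.integral_add integrable_cmul)
    finally show ?thesis .
  qed
  then show ?thesis using sg unfolding One_nat_def vanishing.simps by blast
qed

section \<open>Taylor coefficients\<close>

lemma partial_eq_frechet_derivative: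
  assumes "smooth_on U f" "p \<in> U"
  shows "partial_x f p = frechet_derivative f (at p) (1, 0)"
    and "partial_y f p = frechet_derivative f (at p) (0, 1)"
proof -
  let ?D = "frechet_derivative f (at p)"
  have D: "(f has_derivative ?D) (at (fst p, snd p))"
    using smooth_on_has_derivative[OF assms] by simp
  have scale: "h * ?D (1, 0) = ?D (h, 0)" "h * ?D (0, 1) = ?D (0, h)" for h
    using linear_scale[OF has_derivative_linear[OF D], of h "(1, 0)"]
      linear_scale[OF has_derivative_linear[OF D], of h "(0, 1)"] by simp_all
  have "((\<lambda>t. (t, snd p)) has_derivative (\<lambda>h. (h, 0))) (at (fst p))"
    by (intro has_derivative_Pair has_derivative_ident has_derivative_const)
  from diff_chain_at[OF this D] have "((\<lambda>t. f (t, snd p)) has_derivative (\<lambda>h. ?D (h, 0))) (at (fst p))"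
    by (simp add: o_def)
  then have "((\<lambda>t. f (t, snd p)) has_field_derivative ?D (1, 0)) (at (fst p))"
    by (rule has_derivative_imp_has_field_derivative) (rule scale)
  then show "partial_x f p = ?D (1, 0)" unfolding partial_x_def by (rule DERIV_imp_deriv)
  have "((\<lambda>t. (fst p, t)) has_derivative (\<lambda>h. (0, h))) (at (snd p))"
    by (intro has_derivative_Pair has_derivative_ident has_derivative_const)
  from diff_chain_at[OF this D] have "((\<lambda>t. f (fst p, t)) has_derivative (\<lambda>h. ?D (0, h))) (at (snd p))"
    by (simp add: o_def)
  then have "((\<lambda>t. f (fst p, t)) has_field_derivative ?D (0, 1)) (at (snd p))"
    by (rule has_derivative_imp_has_field_derivative) (rule scale)
  then show "partial_y f p = ?D (0, 1)" unfolding partial_y_def by (rule DERIV_imp_deriv)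
qed

abbreviation mixed_partial :: "nat \<Rightarrow> nat \<Rightarrow> (plane \<Rightarrow> real) \<Rightarrow> plane \<Rightarrow> real" where
  "mixed_partial i j f \<equiv> (partial_x ^^ i) ((partial_y ^^ j) f)"

text \<open>Each partial derivative costs one power. Subtraction is truncated, so for
  \<open>i + j \<ge> n\<close> the claim is plain smoothness, and \<open>n = 0\<close> gives
  smoothness of all mixed partials.\<close>

lemma vanishing_mixed_partial:
  assumes "open U" "vanishing U (\<lambda>p. p) n f"
  shows "vanishing U (\<lambda>p. p) (n - (i + j)) (mixed_partial i j f)"
proof -
  note id = assms(1) smooth_on_ident[OF assms(1)]
  have step: "vanishing U (\<lambda>p. p) (n - 1) (partial_x g)" "vanishing U (\<lambda>p. p) (n - 1) (partial_y g)"
    if "vanishing U (\<lambda>p. p) n g" for n g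
  proof -
    have sg: "smooth_on U g" using vanishing_smooth[OF id that] .
    have "vanishing U (\<lambda>p. p) (n - 1) (\<lambda>p. frechet_derivative g (at p) v)" for v
    proof (cases n)
      case (Suc m)
      then show ?thesis
        using vanishing_frechet_derivative[OF id, of m g v] that by (simp del: vanishing.simps)
    qed (simp add: smooth_on_frechet_derivative[OF sg])
    then show "vanishing U (\<lambda>p. p) (n - 1) (partial_x g)" "vanishing U (\<lambda>p. p) (n - 1) (partial_y g)"
      using vanishing_cong[OF id, of "partial_x g", OF partial_eq_frechet_derivative(1)[OF sg]]
        vanishing_cong[OF id, of "partial_y g", OF partial_eq_frechet_derivative(2)[OF sg]] by simp_all
  qed
  have y: "vanishing U (\<lambda>p. p) (n - j) ((partial_y ^^ j) f)"
  proof (induction j)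
    case (Suc j)
    then show ?case using step(2)[OF Suc] by simp
  qed (simp add: assms)
  have "vanishing U (\<lambda>p. p) (n - j - i) (mixed_partial i j f)"
  proof (induction i)
    case (Suc i)
    then show ?case using step(1)[OF Suc] by simp
  qed (simp add: y)
  then show ?thesis by (simp add: add.commute)
qed

lemma mixed_partial_smooth:
  assumes "open U" "smooth_on U f"
  shows "smooth_on U (mixed_partial i j f)"
  using vanishing_mixed_partial[of U 0 f] assms by simp

lemma mixed_partial_add:
  assumes "open U" "smooth_on U g" "smooth_on U h" "\<And>p. p \<in> U \<Longrightarrow> f p = g p + h p" "p \<in> U"
  shows "mixed_partial i j f p = mixed_partial i j g p + mixed_partial i j h p"
proof -
  have step: "partial_x f p = partial_x g p + partial_x h p \<and> partial_y f p = partial_y g p + partial_y h p"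
    if gh: "smooth_on U g" "smooth_on U h" and f: "\<And>p. p \<in> U \<Longrightarrow> f p = g p + h p" and p: "p \<in> U"
    for f g h p
  proof -
    have "smooth_on U (\<lambda>p. g p + h p)" by (intro smooth_on_add assms(1) gh)
    then have sf: "smooth_on U f" using smooth_on_cong[OF assms(1), of f "\<lambda>p. g p + h p"] f by simp
    have "((\<lambda>p. g p + h p) has_derivative
        (\<lambda>v. frechet_derivative g (at p) v + frechet_derivative h (at p) v)) (at p)"
      by (intro has_derivative_add smooth_on_has_derivative[OF _ p] gh)
    then have "(f has_derivative
        (\<lambda>v. frechet_derivative g (at p) v + frechet_derivative h (at p) v)) (at p)"
      by (rule has_derivative_transform_within_open[OF _ assms(1) p]) (simp add: f)
    then have "frechet_derivative f (at p) v = frechet_derivative g (at p) v + frechet_derivative h (at p) v" for v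
      by (rule frechet_derivative_at[THEN fun_cong, symmetric])
    then show ?thesis
      by (simp add: partial_eq_frechet_derivative[OF sf p] partial_eq_frechet_derivative[OF gh(1) p]
          partial_eq_frechet_derivative[OF gh(2) p])
  qed
  have y: "p \<in> U \<Longrightarrow> (partial_y ^^ j) f p = (partial_y ^^ j) g p + (partial_y ^^ j) h p" for p
  proof (induction j arbitrary: p)
    case (Suc j)
    then show ?case
      using step[of "(partial_y ^^ j) g" "(partial_y ^^ j) h" "(partial_y ^^ j) f" p]
        mixed_partial_smooth[OF assms(1,2), of 0 j] mixed_partial_smooth[OF assms(1,3), of 0 j] by simp
  qed (simp add: assms(4))
  have "p \<in> U \<Longrightarrow> mixed_partial i j f p = mixed_partial i j g p + mixed_partial i j h p" for p
  proof (induction i arbitrary: p)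
    case (Suc i)
    then show ?case
      using step[of "mixed_partial i j g" "mixed_partial i j h" "mixed_partial i j f" p]
        mixed_partial_smooth[OF assms(1,2), of i j] mixed_partial_smooth[OF assms(1,3), of i j] by simp
  qed (simp add: y)
  then show ?thesis using assms(5) .
qed

section \<open>Taylor coefficients of polynomials\<close>

lemma partial_monomial:
  "partial_x (\<lambda>p. c * fst p ^ a * snd p ^ b) = (\<lambda>p. (c * real a) * fst p ^ (a - 1) * snd p ^ b)"
  "partial_y (\<lambda>p. c * fst p ^ a * snd p ^ b) = (\<lambda>p. (c * real b) * fst p ^ a * snd p ^ (b - 1))"
  unfolding partial_x_def partial_y_def
  by (intro ext DERIV_imp_deriv; auto intro!: derivative_eq_intros)+

lemma mixed_partial_monomial:
  "mixed_partial i j (\<lambda>p. c * fst p ^ a * snd p ^ b) =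
    (\<lambda>p. c * (\<Prod>k<j. real (b - k)) * (\<Prod>k<i. real (a - k)) * fst p ^ (a - i) * snd p ^ (b - j))"
proof -
  have "(partial_y ^^ j) (\<lambda>p. c * fst p ^ a * snd p ^ b) =
      (\<lambda>p. c * (\<Prod>k<j. real (b - k)) * fst p ^ a * snd p ^ (b - j))"
    by (induction j) (simp_all add: partial_monomial mult.assoc[symmetric])
  then show ?thesis
    by (induction i) (simp_all add: partial_monomial mult.assoc[symmetric])
qed

text \<open>For \<open>i \<noteq> a\<close> equal total degrees force \<open>a < i\<close> or
  \<open>b < j\<close>, and the corresponding falling factorial contains the factor 0.\<close>

lemma mixed_partial_monomial_0:
  assumes "i + j = a + b"
  shows "mixed_partial i j (\<lambda>p. c * fst p ^ a * snd p ^ b) 0 = (if i = a then c * fact a * fact b else 0)"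
proof (cases "i = a")
  case True
  then have "j = b" using assms by simp
  have "(\<Prod>k<n. real (n - k)) = fact n" for n
    by (simp add: fact_prod_rev atLeast0LessThan)
  then show ?thesis using True \<open>j = b\<close> by (simp add: mixed_partial_monomial)
next
  case False
  then consider "a < i" | "b < j" using assms by linarith
  then show ?thesis
  proof cases
    case 1
    then have "(\<Prod>k<i. real (a - k)) = 0" by (intro prod_zero) auto
    then show ?thesis using False by (simp add: mixed_partial_monomial)
  next
    case 2
    then have "(\<Prod>k<j. real (b - k)) = 0" by (intro prod_zero) auto
    then show ?thesis using False by (simp add: mixed_partial_monomial)
  qed
qed

lemma mixed_partial_sum:
  assumes "open U" "finite I" "\<And>k. k \<in> I \<Longrightarrow> smooth_on U (f k)" "p \<in> U"
  shows "mixed_partial i j (\<lambda>p. \<Sum>k\<in>I. f k p) p = (\<Sum>k\<in>I. mixed_partial i j (f k) p)"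
  using assms(2,3)
proof (induction I rule: finite_induct)
  case empty
  \<comment> \<open>The zero function is treated as a monomial with coefficient 0.\<close>
  then show ?case using mixed_partial_monomial[of i j 0 0 0] by simp
next
  case (insert x I)
  then show ?case
    using mixed_partial_add[OF assms(1) _ _ _ assms(4), of "f x" "\<lambda>p. \<Sum>k\<in>I. f k p"
        "\<lambda>p. \<Sum>k\<in>insert x I. f k p"] smooth_on_sum[OF assms(1), of I f] by simp
qed

lemma le_germ_order_iff:
  "enat n \<le> germ_order f \<longleftrightarrow> (\<forall>i j. i + j < n \<longrightarrow> mixed_partial i j f 0 = 0)"
proof -
  have "enat n \<le> germ_order f \<longleftrightarrow> (\<forall>i j. taylor_coeff f i j \<noteq> 0 \<longrightarrow> n \<le> i + j)"
  proof -
    have "(\<forall>x\<in>{enat (i + j) | i j. taylor_coeff f i j \<noteq> 0}. enat n \<le> x) \<longleftrightarrow>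
        (\<forall>i j. taylor_coeff f i j \<noteq> 0 \<longrightarrow> enat n \<le> enat (i + j))" by blast
    then show ?thesis unfolding germ_order_def le_Inf_iff by simp
  qed
  then show ?thesis by (simp add: taylor_coeff_def not_le[symmetric]) blast
qed

lemma vanishing_imp_germ_order:
  assumes "open U" "0 \<in> U" "vanishing U (\<lambda>p. p) n f"
  shows "enat n \<le> germ_order f"
  unfolding le_germ_order_iff
proof (intro allI impI)
  fix i j :: nat assume "i + j < n"
  then obtain m where "n - (i + j) = Suc m" by (metis Suc_diff_Suc)
  then show "mixed_partial i j f 0 = 0"
    using vanishing_mixed_partial[OF assms(1,3), of i j] assms(2) by (auto simp: zero_prod_def)
qed

lemma germ_order_imp_vanishing:
  assumes "enat N \<le> germ_order f" and f: "smooth_on (ball 0 r) f" and "0 < r"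
  shows "vanishing (ball 0 r) (\<lambda>p. p) N f"
proof -
  let ?U = "ball (0::plane) r"
  note id = open_ball[of "0::plane" r] smooth_on_ident[OF open_ball, of "0::plane" r]
  have zero: "i + j < N \<Longrightarrow> mixed_partial i j f 0 = 0" for i j
    using assms(1) by (simp add: le_germ_order_iff)
  have "n \<le> N \<Longrightarrow> vanishing ?U (\<lambda>p. p) n f" for n
  proof (induction n)
    case 0
    then show ?case using f by simp
  next
    case (Suc n)
    then have "vanishing ?U (\<lambda>p. p) n f" by simp
    then obtain G where G: "\<And>i. smooth_on ?U (G i)"
      "\<And>p. p \<in> ?U \<Longrightarrow> f p = (\<Sum>i\<le>n. G i p * fst p ^ i * snd p ^ (n - i))"
      using vanishing_expansion[OF id, of n f] by blast
    define q where "q p = (\<Sum>i\<le>n. G i 0 * fst p ^ i * snd p ^ (n - i))" for p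
    define h where "h p = (\<Sum>i\<le>n. (G i p - G i 0) * (fst p ^ i * snd p ^ (n - i)))" for p
    have "vanishing ?U (\<lambda>p. p) (1 + (i * 1 + (n - i) * 1))
        (\<lambda>p. (G i p - G i 0) * (fst p ^ i * snd p ^ (n - i)))" if "i \<le> n" for i
      by (intro vanishing_mult[OF id] vanishing_power[OF id] hadamard G
          vanishing_fst[OF id] vanishing_snd[OF id])
    then have hv: "vanishing ?U (\<lambda>p. p) (Suc n) h"
      unfolding h_def[abs_def] by (intro vanishing_sum[OF id]) simp
    have fqh: "f p = q p + h p" if "p \<in> ?U" for p
      using G(2)[OF that] by (simp add: q_def h_def sum.distrib[symmetric] algebra_simps)
    have sm: "smooth_on ?U (\<lambda>p. G k 0 * fst p ^ k * snd p ^ (n - k))" for k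
      by (intro smooth_intros open_ball)
    then have sq: "smooth_on ?U q" unfolding q_def[abs_def] by (intro smooth_on_sum open_ball)
    have "G i 0 = 0" if "i \<le> n" for i
    proof -
      have "mixed_partial i (n - i) h 0 = 0"
        using vanishing_mixed_partial[OF open_ball hv, of i "n - i"] that \<open>0 < r\<close>
        by (auto simp: zero_prod_def)
      then have "0 = mixed_partial i (n - i) q 0"
        using mixed_partial_add[OF open_ball sq vanishing_smooth[OF id hv] fqh, of 0 i "n - i"]
          zero[of i "n - i"] Suc.prems that \<open>0 < r\<close> by simp
      also have "\<dots> = (\<Sum>k\<le>n. mixed_partial i (n - i) (\<lambda>p. G k 0 * fst p ^ k * snd p ^ (n - k)) 0)"
        unfolding q_def[abs_def] by (rule mixed_partial_sum[OF open_ball]) (use sm \<open>0 < r\<close> in auto)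
      also have "\<dots> = (\<Sum>k\<le>n. if i = k then G k 0 * fact k * fact (n - k) else 0)"
        by (intro sum.cong refl mixed_partial_monomial_0) (use that in auto)
      also have "\<dots> = G i 0 * fact i * fact (n - i)" using that by simp
      finally show ?thesis by simp
    qed
    then have "f p = h p" if "p \<in> ?U" for p using fqh[OF that] by (simp add: q_def)
    then show ?case using hv by (subst vanishing_cong[OF id])
  qed
  then show ?thesis by simp
qed

section \<open>Homogeneous polynomials\<close>

definition hom_poly :: "nat \<Rightarrow> (nat \<Rightarrow> real) \<Rightarrow> plane \<Rightarrow> real" where
  "hom_poly d a p = (\<Sum>i\<le>d. a i * fst p ^ i * snd p ^ (d - i))"

lemma homogeneous_polynomial_iff: "homogeneous_polynomial d f \<longleftrightarrow> (\<exists>a. f = hom_poly d a)"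
  unfolding homogeneous_polynomial_def hom_poly_def fun_eq_iff by auto

lemma partial_hom_poly:
  "partial_x (hom_poly (Suc d) a) = hom_poly d (\<lambda>i. real (Suc i) * a (Suc i))"
  "partial_y (hom_poly (Suc d) a) = hom_poly d (\<lambda>i. real (Suc d - i) * a i)"
proof -
  have "partial_x (hom_poly (Suc d) a) p =
      (\<Sum>i\<le>Suc d. a i * (real i * fst p ^ (i - 1)) * snd p ^ (Suc d - i))" for p
    unfolding partial_x_def hom_poly_def
    by (rule DERIV_imp_deriv, rule DERIV_sum) (auto intro!: derivative_eq_intros)
  then show "partial_x (hom_poly (Suc d) a) = hom_poly d (\<lambda>i. real (Suc i) * a (Suc i))"
    by (simp add: fun_eq_iff hom_poly_def sum.atMost_Suc_shift mult_ac del: sum.atMost_Suc of_nat_Suc)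
  have "partial_y (hom_poly (Suc d) a) p =
      (\<Sum>i\<le>Suc d. a i * fst p ^ i * (real (Suc d - i) * snd p ^ (d - i)))" for p
    unfolding partial_y_def hom_poly_def
    by (rule DERIV_imp_deriv, rule DERIV_sum) (auto intro!: derivative_eq_intros)
  then show "partial_y (hom_poly (Suc d) a) = hom_poly d (\<lambda>i. real (Suc d - i) * a i)"
    by (simp add: fun_eq_iff hom_poly_def mult_ac)
qed

lemma laplacian_hom_poly:
  "laplacian (hom_poly (Suc (Suc d)) a) = hom_poly d (\<lambda>i. real (Suc i) * real (Suc (Suc i)) * a (Suc (Suc i))
      + real (Suc d - i) * real (Suc (Suc d) - i) * a i)"
proof
  fix p
  show "laplacian (hom_poly (Suc (Suc d)) a) p = hom_poly d (\<lambda>i. real (Suc i) * real (Suc (Suc i)) * a (Suc (Suc i))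
      + real (Suc d - i) * real (Suc (Suc d) - i) * a i) p"
    unfolding laplacian_def partial_hom_poly
    by (simp only: hom_poly_def sum.distrib[symmetric] distrib_right mult.assoc)
qed

lemma laplacian3_hom_poly:
  "(laplacian ^^ 3) (hom_poly 6 a) = (\<lambda>p. 720 * (a 6 + a 0) + 144 * (a 4 + a 2))"
proof -
  have 6: "(6::nat) = Suc (Suc (Suc (Suc (Suc (Suc 0)))))" by simp
  have "(laplacian ^^ 3) (hom_poly 6 a) = laplacian (laplacian (laplacian (hom_poly 6 a)))"
    by (simp add: numeral_3_eq_3)
  also have "\<dots> = (\<lambda>p. 720 * (a 6 + a 0) + 144 * (a 4 + a 2))"
    unfolding 6 laplacian_hom_poly by (simp add: fun_eq_iff hom_poly_def numeral_eq_Suc)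
  finally show ?thesis .
qed

section \<open>Sextic forms modulo the Jacobian ideal\<close>

definition zc :: "plane \<Rightarrow> complex" where
  "zc p = Complex (fst p) (snd p)"

lemma zc_0 [simp]: "zc 0 = 0"
  by (simp add: zc_def zero_complex.code)

lemma f5_eq: "f5 p = Re (zc p ^ 5)"
  by (simp add: f5_def zc_def Complex_eq)

text \<open>The general quadratic form in \<open>z\<close> and \<open>cnj z\<close>. Its three
  coefficients are packed into one point of a Euclidean space, because they become the unknown of
  the implicit function theorem.\<close>

definition quad :: "complex \<Rightarrow> complex \<times> complex \<times> complex \<Rightarrow> complex" where
  "quad z \<theta> = fst \<theta> * z ^ 2 + fst (snd \<theta>) * (z * cnj z) + snd (snd \<theta>) * cnj z ^ 2"

lemma quad_add: "quad z (s + t) = quad z s + quad z t"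
  by (simp add: quad_def algebra_simps)

lemma quad_scaleR: "quad z (c *\<^sub>R s) = c *\<^sub>R quad z s"
  by (simp add: quad_def scaleR_conv_of_real algebra_simps)

text \<open>The real and imaginary parts of \<open>z\<^sup>6\<close>, \<open>z\<^sup>5 cnj z\<close>, \<open>z\<^sup>4 (cnj z)\<^sup>2\<close> together with
  \<open>(x\<^sup>2 + y\<^sup>2)\<^sup>3\<close> form a basis of the sextic forms; these are the coordinates in this basis.\<close>

definition sextic_coeffs :: "(nat \<Rightarrow> real) \<Rightarrow> complex \<times> complex \<times> complex" where
  "sextic_coeffs g =
    (of_real ((g 6 - g 0 - g 4 + g 2) / 32) - \<i> * of_real ((g 5 + g 1 - g 3) / 32),
     of_real ((3 * (g 6 + g 0) - g 4 - g 2) / 16) - \<i> * of_real ((g 5 - g 1) / 8),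
     of_real ((15 * (g 6 - g 0) + g 4 - g 2) / 32) - \<i> * of_real ((5 * (g 5 + g 1) + 3 * g 3) / 32))"

text \<open>This is \<Delta>^3 divided by 2304: \<Delta>^3 kills the six other basis forms, and it
  sends \<open>(x^2 + y^2)^3\<close> to \<open>36 * 16 * 4 = 2304\<close>.\<close>

definition sextic_trace :: "(nat \<Rightarrow> real) \<Rightarrow> real" where
  "sextic_trace g = (5 * (g 6 + g 0) + g 4 + g 2) / 16"

lemma hom_poly_6_normal_form:
  "hom_poly 6 g p = Re (zc p ^ 4 * quad (zc p) (sextic_coeffs g)) + sextic_trace g * (fst p ^ 2 + snd p ^ 2) ^ 3"
proof -
  obtain x y where p: "p = (x, y)" by (cases p)
  have 6: "{..6::nat} = {0,1,2,3,4,5,6}" by auto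
  have z2: "Complex x y ^ 2 = Complex (x^2 - y^2) (2 * x * y)"
    by (simp add: complex_eq_iff power2_eq_square)
  have "Complex x y ^ 4 = (Complex x y ^ 2) ^ 2" by simp
  then have z4: "Complex x y ^ 4 = Complex (x^4 - 6 * x^2 * y^2 + y^4) (4 * x^3 * y - 4 * x * y^3)"
    unfolding z2 by (simp add: complex_eq_iff eval_nat_numeral algebra_simps)
  have zz: "Complex x y * cnj (Complex x y) = Complex (x^2 + y^2) 0"
    by (simp add: complex_eq_iff power2_eq_square)
  have c2: "cnj (Complex x y) ^ 2 = Complex (x^2 - y^2) (- (2 * x * y))"
    by (simp add: complex_eq_iff power2_eq_square)
  \<comment> \<open>Since Re ((a - \<i> b) w) = a Re w + b Im w, the numbers \<open>a0\<close>,
    \<open>b0\<close> and so on are real coordinates in the basis. Equating the seven coefficients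
    with those of \<open>hom_poly 6 g\<close> is a linear system; its solution is
    \<open>sextic_coeffs\<close> and \<open>sextic_trace\<close>.\<close>
  have expand: "Re (Complex x y ^ 4 * quad (Complex x y) (of_real a0 - \<i> * of_real b0,
      of_real a1 - \<i> * of_real b1, of_real a2 - \<i> * of_real b2)) + m * (x^2 + y^2)^3 =
      (a0 + a1 + a2 + m) * x^6 + (6 * b0 + 4 * b1 + 2 * b2) * x^5 * y
      + (a2 - 15 * a0 - 5 * a1 + 3 * m) * x^4 * y^2 + (4 * b2 - 20 * b0) * x^3 * y^3
      + (15 * a0 - 5 * a1 - a2 + 3 * m) * x^2 * y^4 + (6 * b0 - 4 * b1 + 2 * b2) * x * y^5
      + (a1 - a0 - a2 + m) * y^6" for a0 a1 a2 b0 b1 b2 m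
    unfolding quad_def z4 fst_conv snd_conv zz z2 c2
    by (simp add: eval_nat_numeral algebra_simps)
  show ?thesis
    unfolding p hom_poly_def 6 sextic_coeffs_def sextic_trace_def zc_def fst_conv snd_conv expand
    by (simp add: add_divide_distrib diff_divide_distrib)
qed

lemma smooth_on_sextic_coeffs:
  assumes "open U" "\<And>i. smooth_on U (G i)"
  shows "smooth_on U (\<lambda>p. sextic_coeffs (\<lambda>i. G i p))" "smooth_on U (\<lambda>p. sextic_trace (\<lambda>i. G i p))"
  unfolding sextic_coeffs_def sextic_trace_def divide_inverse by (intro smooth_intros assms)+

text \<open>Splitting off one coordinate leaves two forms of degree 6 with smooth coefficients.
  Their traces give the surplus \<open>(x a + y b) (x^2 + y^2)^3\<close>, which equals Re (z^4 (cnj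
  z)^2 (cnj z (a - \<i> b))) and is thus absorbed by the third coefficient.\<close>

lemma vanishing_7_normal_form:
  fixes f :: "'a::euclidean_space \<Rightarrow> real"
  assumes U: "open U" and \<pi>: "smooth_on U \<pi>" and f: "vanishing U \<pi> 7 f"
  shows "\<exists>E. vanishing U \<pi> 1 E \<and> (\<forall>p\<in>U. f p = Re (zc (\<pi> p) ^ 4 * quad (zc (\<pi> p)) (E p)))"
proof -
  have "vanishing U \<pi> (Suc 6) f" using f by simp
  then obtain g h where gh: "vanishing U \<pi> 6 g" "vanishing U \<pi> 6 h"
    "\<And>p. p \<in> U \<Longrightarrow> f p = fst (\<pi> p) *\<^sub>R g p + snd (\<pi> p) *\<^sub>R h p"
    by (rule vanishing_SucE) blast
  obtain G where G: "\<And>i. smooth_on U (G i)" "\<And>p. p \<in> U \<Longrightarrow> g p = hom_poly 6 (\<lambda>i. G i p) (\<pi> p)"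
    using vanishing_expansion[OF U \<pi> gh(1)] unfolding hom_poly_def by blast
  obtain H where H: "\<And>i. smooth_on U (H i)" "\<And>p. p \<in> U \<Longrightarrow> h p = hom_poly 6 (\<lambda>i. H i p) (\<pi> p)"
    using vanishing_expansion[OF U \<pi> gh(2)] unfolding hom_poly_def by blast
  define t where "t p = of_real (sextic_trace (\<lambda>i. G i p)) - \<i> * of_real (sextic_trace (\<lambda>i. H i p))" for p
  \<comment> \<open>In \<open>x A + y B\<close> the corrections add up to
    \<open>(x - \<i> y) t = cnj z * t\<close>, as \<open>q3\<close> requires.\<close>
  define A where "A p = sextic_coeffs (\<lambda>i. G i p) + (0, 0, t p)" for p
  define B where "B p = sextic_coeffs (\<lambda>i. H i p) + (0, 0, - \<i> * t p)" for p
  define E where "E p = fst (\<pi> p) *\<^sub>R A p + snd (\<pi> p) *\<^sub>R B p" for p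
  have t: "smooth_on U t"
    unfolding t_def[abs_def] by (intro smooth_intros U smooth_on_sextic_coeffs G H)
  have "smooth_on U A" "smooth_on U B" unfolding A_def[abs_def] B_def[abs_def]
    by (intro smooth_intros U smooth_on_sextic_coeffs G H t)+
  then have "vanishing U \<pi> 1 E" unfolding One_nat_def
    by (intro vanishing_SucI[of _ _ _ A B]) (simp_all add: E_def)
  moreover have "f p = Re (zc (\<pi> p) ^ 4 * quad (zc (\<pi> p)) (E p))" if "p \<in> U" for p
  proof -
    obtain x y where p: "\<pi> p = (x, y)" by (cases "\<pi> p")
    have tp: "t p = Complex (sextic_trace (\<lambda>i. G i p)) (- sextic_trace (\<lambda>i. H i p))"
      by (simp add: t_def complex_eq_iff)
    have q3: "Re (zc (x, y) ^ 4 * quad (zc (x, y)) (0, 0, cnj (zc (x, y)) * Complex a (- b))) =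
        (x * a + y * b) * (x ^ 2 + y ^ 2) ^ 3" for a b
      unfolding quad_def zc_def by (simp add: eval_nat_numeral algebra_simps)
    have "E p = x *\<^sub>R sextic_coeffs (\<lambda>i. G i p) + y *\<^sub>R sextic_coeffs (\<lambda>i. H i p)
        + (0, 0, cnj (zc (x, y)) * t p)"
      by (simp add: E_def A_def B_def p zc_def prod_eq_iff complex_eq_iff algebra_simps)
    then have "Re (zc (\<pi> p) ^ 4 * quad (zc (\<pi> p)) (E p)) =
        x * Re (zc (x, y) ^ 4 * quad (zc (x, y)) (sextic_coeffs (\<lambda>i. G i p)))
        + y * Re (zc (x, y) ^ 4 * quad (zc (x, y)) (sextic_coeffs (\<lambda>i. H i p)))
        + (x * sextic_trace (\<lambda>i. G i p) + y * sextic_trace (\<lambda>i. H i p)) * (x ^ 2 + y ^ 2) ^ 3"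
      unfolding p tp
      by (simp only: quad_add quad_scaleR distrib_left mult_scaleR_right plus_complex.sel
          scaleR_complex.sel q3)
    also have "\<dots> = x * g p + y * h p"
      unfolding G(2)[OF that] H(2)[OF that] p hom_poly_6_normal_form by (simp add: algebra_simps)
    finally show ?thesis using gh(3)[OF that] p by simp
  qed
  ultimately show ?thesis by blast
qed

section \<open>Solving for the change of coordinates\<close>

lemma vanishing_zc:
  assumes "open U" "smooth_on U \<pi>"
  shows "vanishing U \<pi> 1 (\<lambda>p. zc (\<pi> p))"
  unfolding One_nat_def
  by (rule vanishing_SucI[of _ _ _ "\<lambda>q. 1" "\<lambda>q. \<i>"])
    (auto simp: smooth_on_const zc_def complex_eq_iff)

lemma vanishing_quad:
  assumes U: "open U" and \<pi>: "smooth_on U \<pi>" and \<theta>: "smooth_on U \<theta>"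
  shows "vanishing U \<pi> 2 (\<lambda>p. quad (zc (\<pi> p)) (\<theta> p))"
proof -
  note z = vanishing_zc[OF U \<pi>]
  note cz = vanishing_linear_compose[OF U \<pi> bounded_linear_cnj z]
  have sq: "vanishing U \<pi> 2 (\<lambda>p. zc (\<pi> p) ^ 2)" "vanishing U \<pi> 2 (\<lambda>p. cnj (zc (\<pi> p)) ^ 2)"
    "vanishing U \<pi> 2 (\<lambda>p. zc (\<pi> p) * cnj (zc (\<pi> p)))"
    using vanishing_power[OF U \<pi> z, of 2] vanishing_power[OF U \<pi> cz, of 2] vanishing_mult[OF U \<pi> z cz]
    by (simp_all only: mult_1_right one_add_one)
  show ?thesis unfolding quad_def
    by (intro vanishing_add[OF U \<pi>] sq[THEN vanishing_smooth_mult[OF U \<pi>, rotated]]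
        smooth_on_fst[OF U] smooth_on_snd[OF U] \<theta>)
qed

text \<open>Order 1 for \<open>z\<close> and order 2 for \<open>w\<close> put \<open>z^a w^b\<close>
  into the power \<open>a + 2 b\<close>. In the two binomial expansions only \<open>z^5\<close>,
  \<open>5 z^4 w\<close> and the sixth power of the first coordinate stay below 7, and exactly these
  are subtracted. The coefficients \<open>snd q\<close> are free variables here.\<close>

lemma vanishing_residual:
  fixes \<kappa> :: real
  defines "w \<equiv> \<lambda>q::plane \<times> complex \<times> complex \<times> complex. quad (zc (fst q)) (snd q)"
  shows "vanishing UNIV fst 7 (\<lambda>q. Re ((zc (fst q) + w q) ^ 5) + \<kappa> * (fst (fst q) + Re (w q)) ^ 6
    - Re (zc (fst q) ^ 5) - \<kappa> * fst (fst q) ^ 6 - Re (zc (fst q) ^ 4 * quad (zc (fst q)) (5 *\<^sub>R snd q)))"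
proof -
  let ?v = "vanishing (UNIV :: (plane \<times> complex \<times> complex \<times> complex) set) fst"
  let ?z = "\<lambda>q::plane \<times> complex \<times> complex \<times> complex. zc (fst q)"
  have c: "open (UNIV :: (plane \<times> complex \<times> complex \<times> complex) set)"
      "smooth_on (UNIV :: (plane \<times> complex \<times> complex \<times> complex) set) fst"
    by (simp, intro smooth_on_linear open_UNIV bounded_linear_fst)
  have z: "?v 1 ?z" by (rule vanishing_zc[OF c])
  have w: "?v 2 w" unfolding w_def
    by (rule vanishing_quad[OF c]) (intro smooth_on_linear open_UNIV bounded_linear_snd)
  have x: "?v 1 (\<lambda>q. fst (fst q))" using vanishing_fst[OF c] .
  have u: "?v 2 (\<lambda>q. Re (w q))" by (rule vanishing_linear_compose[OF c bounded_linear_Re w])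
  have 1: "?v 7 (\<lambda>q. ?z q ^ a * w q ^ b)" if "7 \<le> a + 2 * b" for a b
    using vanishing_mult[OF c vanishing_power[OF c z, of a] vanishing_power[OF c w, of b]]
    by (rule vanishing_mono[OF c]) (use that in simp)
  have 2: "?v 7 (\<lambda>q. fst (fst q) ^ a * Re (w q) ^ b)" if "7 \<le> a + 2 * b" for a b
    using vanishing_mult[OF c vanishing_power[OF c x, of a] vanishing_power[OF c u, of b]]
    by (rule vanishing_mono[OF c]) (use that in simp)
  \<comment> \<open>The exponents 0 and 1 are written out so that each term matches fact
    \<open>1\<close> or \<open>2\<close>.\<close>
  have "?v 7 (\<lambda>q. Re (10 * (?z q ^ 3 * w q ^ 2) + 10 * (?z q ^ 2 * w q ^ 3) + 5 * (?z q ^ 1 * w q ^ 4)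
        + ?z q ^ 0 * w q ^ 5)
      + \<kappa> * (6 * (fst (fst q) ^ 5 * Re (w q) ^ 1) + 15 * (fst (fst q) ^ 4 * Re (w q) ^ 2)
        + 20 * (fst (fst q) ^ 3 * Re (w q) ^ 3) + 15 * (fst (fst q) ^ 2 * Re (w q) ^ 4)
        + 6 * (fst (fst q) ^ 1 * Re (w q) ^ 5) + fst (fst q) ^ 0 * Re (w q) ^ 6))"
    by (intro vanishing_add[OF c] vanishing_linear_compose[OF c bounded_linear_Re]
        vanishing_smooth_mult[OF c smooth_on_const] 1 2) simp_all
  moreover have "Re ((z + t) ^ 5) + \<kappa> * (r + s) ^ 6 - Re (z ^ 5) - \<kappa> * r ^ 6 - Re (z ^ 4 * (5 *\<^sub>R t)) =
      Re (10 * (z ^ 3 * t ^ 2) + 10 * (z ^ 2 * t ^ 3) + 5 * (z ^ 1 * t ^ 4) + z ^ 0 * t ^ 5)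
      + \<kappa> * (6 * (r ^ 5 * s ^ 1) + 15 * (r ^ 4 * s ^ 2) + 20 * (r ^ 3 * s ^ 3) + 15 * (r ^ 2 * s ^ 4)
        + 6 * (r ^ 1 * s ^ 5) + r ^ 0 * s ^ 6)" for z t :: complex and r s
  proof -
    have e1: "(z + t) ^ 5 = z ^ 5 + z ^ 4 * (5 *\<^sub>R t)
        + (10 * (z ^ 3 * t ^ 2) + 10 * (z ^ 2 * t ^ 3) + 5 * (z ^ 1 * t ^ 4) + z ^ 0 * t ^ 5)"
      by (simp add: scaleR_conv_of_real eval_nat_numeral algebra_simps)
    have e2: "(r + s) ^ 6 = r ^ 6 + (6 * (r ^ 5 * s ^ 1) + 15 * (r ^ 4 * s ^ 2)
        + 20 * (r ^ 3 * s ^ 3) + 15 * (r ^ 2 * s ^ 4) + 6 * (r ^ 1 * s ^ 5) + r ^ 0 * s ^ 6)"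
      by (simp add: eval_nat_numeral algebra_simps)
    show ?thesis
      unfolding e1 e2 plus_complex.sel(1) distrib_left[of \<kappa> "r ^ 6"] by simp
  qed
  ultimately show ?thesis unfolding quad_scaleR w_def by (simp only:)
qed

section \<open>Diffeomorphism germs and right equivalence\<close>

lemma diffeo_germ_smooth:
  assumes "open U" "0 \<in> U" "smooth_on U \<tau>" "\<tau> 0 = 0" "inj (frechet_derivative \<tau> (at 0))"
  shows "diffeo_germ \<tau>"
proof -
  obtain U' V g where "open U'" "U' \<subseteq> U" "0 \<in> U'" "open V" "homeomorphism U' V \<tau> g" "smooth_on V g"
    using smooth_inverse_function[OF assms(1,3,2,5)] by metis
  then show ?thesis
    unfolding diffeo_germ_def using assms(3,4) smooth_on_subset by blast
qed

text \<open>Needed because the construction below starts from the normal form and reaches the given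
  germ.\<close>

lemma right_equivalent_sym:
  assumes "right_equivalent h1 h2"
  shows "right_equivalent h2 h1"
proof -
  obtain \<tau> U V \<sigma> where \<tau>: "\<tau> 0 = 0" "open U" "open V" "0 \<in> U" "homeomorphism U V \<tau> \<sigma>"
    "smooth_on U \<tau>" "smooth_on V \<sigma>" and eq: "\<forall>\<^sub>F p in nhds 0. h1 (\<tau> p) = h2 p"
    using assms unfolding right_equivalent_def right_equivalent_via_def diffeo_germ_def by blast
  have V0: "0 \<in> V" and \<sigma>0: "\<sigma> 0 = 0"
    using \<tau> by (metis homeomorphism_def imageI)+
  have "diffeo_germ \<sigma>"
    unfolding diffeo_germ_def using \<tau> V0 \<sigma>0 homeomorphism_sym by blast
  moreover have "\<forall>\<^sub>F q in nhds 0. h2 (\<sigma> q) = h1 q"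
  proof -
    have "isCont \<sigma> 0"
      using \<tau> V0 by (simp add: homeomorphism_def continuous_on_eq_continuous_at)
    then have "filterlim \<sigma> (nhds (\<sigma> 0)) (nhds 0)"
      unfolding isCont_def tendsto_at_iff_tendsto_nhds .
    then have "filterlim \<sigma> (nhds 0) (nhds 0)" by (simp only: \<sigma>0)
    from filterlim_iff[THEN iffD1, OF this, rule_format, OF eq]
    have "\<forall>\<^sub>F q in nhds 0. h1 (\<tau> (\<sigma> q)) = h2 (\<sigma> q)" .
    moreover have "\<forall>\<^sub>F q in nhds 0. q \<in> V" using \<tau>(3) V0 by (rule eventually_nhds_in_open)
    ultimately show ?thesis
      by eventually_elim (use \<tau>(5) in \<open>auto simp: homeomorphism_def\<close>)
  qed
  ultimately show ?thesis unfolding right_equivalent_def right_equivalent_via_def by blast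
qed

text \<open>The substitution is \<open>z + quad z (\<theta> p)\<close>. By
  \<open>vanishing_residual\<close> and \<open>vanishing_7_normal_form\<close> it changes the germ
  by Re (z^4 quad z (5 \<theta> + E (p, \<theta>))), so solving
  \<open>5 \<theta> + E (p, \<theta>) = s p\<close> for \<theta> is enough. The added term
  \<open>w\<close> has order 2, so \<tau> has the identity as derivative at 0.\<close>

lemma right_equivalent_add_jacobian:
  fixes \<kappa> r :: real
  assumes "0 < r" and s: "smooth_on (ball 0 r) s"
    and S: "\<And>p. p \<in> ball 0 r \<Longrightarrow> S p = Re (zc p ^ 4 * quad (zc p) (s p))"
  shows "right_equivalent (\<lambda>p. f5 p + \<kappa> * fst p ^ 6) (\<lambda>p. f5 p + \<kappa> * fst p ^ 6 + S p)"
proof -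
  note c = open_UNIV smooth_on_linear[OF open_UNIV bounded_linear_fst]
  obtain E :: "plane \<times> complex \<times> complex \<times> complex \<Rightarrow> complex \<times> complex \<times> complex"
    where E: "vanishing UNIV fst 1 E" and
    N': "\<And>q. Re ((zc (fst q) + quad (zc (fst q)) (snd q)) ^ 5)
      + \<kappa> * (fst (fst q) + Re (quad (zc (fst q)) (snd q))) ^ 6
      - Re (zc (fst q) ^ 5) - \<kappa> * fst (fst q) ^ 6 - Re (zc (fst q) ^ 4 * quad (zc (fst q)) (5 *\<^sub>R snd q))
      = Re (zc (fst q) ^ 4 * quad (zc (fst q)) (E q))"
    using vanishing_7_normal_form[OF c vanishing_residual[of \<kappa>]] by blast
  have N: "Re ((zc p + quad (zc p) \<theta>) ^ 5) + \<kappa> * (fst p + Re (quad (zc p) \<theta>)) ^ 6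
      - Re (zc p ^ 5) - \<kappa> * fst p ^ 6 - Re (zc p ^ 4 * quad (zc p) (5 *\<^sub>R \<theta>))
      = Re (zc p ^ 4 * quad (zc p) (E (p, \<theta>)))" for p \<theta>
    using N'[of "(p, \<theta>)"] by (simp only: fst_conv snd_conv)
  have E0: "E (0, \<theta>) = 0" for \<theta>
    using vanishing_Suc_eq_0[OF c E[unfolded One_nat_def], of "(0, \<theta>)"] by simp
  define W where "W = (ball 0 r :: plane set) \<times> (UNIV :: (complex \<times> complex \<times> complex) set)"
  define G where "G q = 5 *\<^sub>R snd q + E q - s (fst q)" for q
  have W: "open W" unfolding W_def by (intro open_Times open_ball open_UNIV)
  have sG: "smooth_on W G"
    unfolding G_def[abs_def]
    by (intro smooth_on_diff smooth_on_add smooth_on_scaleR smooth_on_const smooth_on_snd smooth_on_ident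
        smooth_on_subset[OF vanishing_smooth[OF c E]] smooth_on_compose[OF W open_ball s] smooth_on_fst W)
      (auto simp: W_def)
  \<comment> \<open>As \<open>E (0, \<theta>) = 0\<close> for every \<theta>, the equation over the
    origin is just \<open>5 \<theta> = s 0\<close>, with derivative 5 times the identity.\<close>
  define \<theta>0 where "\<theta>0 = (1 / 5) *\<^sub>R s 0"
  have ker: "\<eta> = 0" if "frechet_derivative G (at (0, \<theta>0)) (0, \<eta>) = 0" for \<eta>
  proof -
    have W0: "(0, \<theta>0) \<in> W" using \<open>0 < r\<close> by (simp add: W_def)
    have "((\<lambda>\<theta>. (0::plane, \<theta>)) has_derivative (\<lambda>\<eta>. (0, \<eta>))) (at \<theta>0)"
      by (intro has_derivative_Pair has_derivative_const has_derivative_ident)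
    from diff_chain_at[OF this smooth_on_has_derivative[OF sG W0]]
    have "((\<lambda>\<theta>. G (0, \<theta>)) has_derivative (\<lambda>\<eta>. frechet_derivative G (at (0, \<theta>0)) (0, \<eta>))) (at \<theta>0)"
      by (simp add: o_def)
    moreover have "((\<lambda>\<theta>. G (0, \<theta>)) has_derivative (\<lambda>\<eta>. 5 *\<^sub>R \<eta>)) (at \<theta>0)"
      unfolding G_def by (auto simp: E0 intro!: derivative_eq_intros)
    ultimately have "frechet_derivative G (at (0, \<theta>0)) (0, \<eta>) = 5 *\<^sub>R \<eta>"
      using has_derivative_unique by metis
    then show ?thesis using that by simp
  qed
  obtain V \<theta> where V: "open V" "0 \<in> V" and \<theta>: "smooth_on V \<theta>"
    and sol: "\<And>p. p \<in> V \<Longrightarrow> (p, \<theta> p) \<in> W \<and> G (p, \<theta> p) = 0"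
  proof (rule smooth_implicit_function[OF W sG])
    show "(0, \<theta>0) \<in> W" using \<open>0 < r\<close> by (simp add: W_def)
    show "G (0, \<theta>0) = 0" by (simp add: G_def E0 \<theta>0_def)
  qed (use ker in auto)
  define w where "w p = quad (zc p) (\<theta> p)" for p
  define \<tau> where "\<tau> p = p + (Re (w p), Im (w p))" for p
  note cV = V(1) smooth_on_ident[OF V(1)]
  have w2: "vanishing V (\<lambda>p. p) 2 w"
    unfolding w_def[abs_def] by (rule vanishing_quad[OF cV \<theta>])
  then have sw: "smooth_on V w" by (rule vanishing_smooth[OF cV])
  have s\<tau>: "smooth_on V \<tau>" unfolding \<tau>_def[abs_def] by (intro smooth_intros V sw)
  have "frechet_derivative w (at 0) v = 0" for v
  proof -
    have "vanishing V (\<lambda>p. p) (Suc 0) (\<lambda>p. frechet_derivative w (at p) v)"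
      using vanishing_frechet_derivative[OF cV, of 1 w v] w2 by (simp only: numeral_2_eq_2 One_nat_def)
    from vanishing_Suc_eq_0[OF cV this V(2) refl] show ?thesis .
  qed
  then have "frechet_derivative w (at 0) = (\<lambda>v. 0)" by (rule ext)
  then have "(w has_derivative (\<lambda>v. 0)) (at 0)"
    using smooth_on_has_derivative[OF sw V(2)] by simp
  then have "(\<tau> has_derivative (\<lambda>v. v + (Re 0, Im 0))) (at 0)"
    unfolding \<tau>_def[abs_def]
    by (intro has_derivative_add has_derivative_ident has_derivative_Pair
        bounded_linear.has_derivative[OF bounded_linear_Re] bounded_linear.has_derivative[OF bounded_linear_Im])
  then have D\<tau>: "frechet_derivative \<tau> (at 0) = (\<lambda>v. v)"
    by (simp add: frechet_derivative_at[symmetric] zero_prod_def[symmetric])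
  have "w 0 = 0" using w2 V(2) by (simp add: w_def quad_def)
  then have "\<tau> 0 = 0" by (simp add: \<tau>_def zero_prod_def)
  then have "diffeo_germ \<tau>"
    by (intro diffeo_germ_smooth[OF V s\<tau>]) (simp_all add: D\<tau>)
  moreover have "f5 (\<tau> p) + \<kappa> * fst (\<tau> p) ^ 6 = f5 p + \<kappa> * fst p ^ 6 + S p" if "p \<in> V" for p
  proof -
    have pr: "p \<in> ball 0 r" and eq: "5 *\<^sub>R \<theta> p + E (p, \<theta> p) = s p"
      using sol[OF that] by (auto simp: W_def G_def)
    have "zc (\<tau> p) = zc p + w p" by (simp add: zc_def \<tau>_def complex_eq_iff)
    then have "f5 (\<tau> p) + \<kappa> * fst (\<tau> p) ^ 6 = Re ((zc p + w p) ^ 5) + \<kappa> * (fst p + Re (w p)) ^ 6"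
      by (simp add: f5_eq \<tau>_def)
    also have "\<dots> = f5 p + \<kappa> * fst p ^ 6 + Re (zc p ^ 4 * quad (zc p) (5 *\<^sub>R \<theta> p + E (p, \<theta> p)))"
      using N[of p "\<theta> p"] unfolding quad_add distrib_left plus_complex.sel f5_eq w_def by linarith
    finally show ?thesis by (simp add: eq S[OF pr])
  qed
  then have "\<forall>\<^sub>F p in nhds 0. f5 (\<tau> p) + \<kappa> * fst (\<tau> p) ^ 6 = f5 p + \<kappa> * fst p ^ 6 + S p"
    using eventually_nhds_in_open[OF V] by (auto elim: eventually_mono)
  ultimately show ?thesis unfolding right_equivalent_def right_equivalent_via_def by blast
qed

lemma smooth_on_ball_of_germ:
  assumes "function_germ h"
  obtains r where "0 < r" "smooth_on (ball 0 r) h"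
  using assms unfolding function_germ_def by (meson open_contains_ball smooth_on_subset)

lemma sextic_normal_form:
  assumes "homogeneous_polynomial 6 \<rho>" "function_germ R" "germ_order R \<ge> 7"
  shows "\<exists>c. (laplacian ^^ 3) \<rho> = (\<lambda>p. c) \<and>
    right_equivalent (\<lambda>p. f5 p + \<rho> p + R p) (\<lambda>p. f5 p + c / fact 6 * fst p ^ 6)"
proof -
  obtain a where \<rho>: "\<rho> = hom_poly 6 a" using assms(1) by (auto simp: homogeneous_polynomial_iff)
  obtain r where "0 < r" and sR: "smooth_on (ball 0 r) R"
    using smooth_on_ball_of_germ[OF assms(2)] .
  note cb = open_ball[of "0::plane" r] smooth_on_ident[OF open_ball, of "0::plane" r]
  have "vanishing (ball 0 r) (\<lambda>p. p) 7 R"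
    using germ_order_imp_vanishing[OF _ sR \<open>0 < r\<close>, of 7] assms(3) by (simp add: numeral_eq_enat)
  then obtain E where E: "vanishing (ball 0 r) (\<lambda>p. p) 1 E"
    "\<And>p. p \<in> ball 0 r \<Longrightarrow> R p = Re (zc p ^ 4 * quad (zc p) (E p))"
    using vanishing_7_normal_form[OF cb] by blast
  define c where "c = 720 * (a 6 + a 0) + 144 * (a 4 + a 2)"
  \<comment> \<open>\<Delta>^3 of \<open>x^6\<close> is 6!, so subtracting \<open>c / fact 6\<close>
    times \<open>x^6\<close> cancels the trace and leaves a form in the Jacobian ideal.\<close>
  define g where "g i = a i - (if i = 6 then c / fact 6 else 0)" for i
  have hg: "hom_poly 6 g p = \<rho> p - c / fact 6 * fst p ^ 6" for p
  proof -
    have "hom_poly 6 g p = hom_poly 6 a p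
        - (\<Sum>i\<le>6. (if i = 6 then c / fact 6 else 0) * fst p ^ i * snd p ^ (6 - i))"
      by (simp only: hom_poly_def g_def left_diff_distrib sum_subtractf)
    also have "(\<Sum>i\<le>6. (if i = 6 then c / fact 6 else 0) * fst p ^ i * snd p ^ (6 - i)) =
        (\<Sum>i\<le>6::nat. if i = 6 then c / fact 6 * fst p ^ 6 else 0)"
      by (intro sum.cong) auto
    finally show ?thesis by (simp add: \<rho>)
  qed
  have "sextic_trace g = 0" by (simp add: sextic_trace_def g_def c_def fact_numeral field_simps)
  then have nf: "\<rho> p - c / fact 6 * fst p ^ 6 = Re (zc p ^ 4 * quad (zc p) (sextic_coeffs g))" for p
    using hom_poly_6_normal_form[of g p] by (simp add: hg)
  have "right_equivalent (\<lambda>p. f5 p + c / fact 6 * fst p ^ 6)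
      (\<lambda>p. f5 p + c / fact 6 * fst p ^ 6 + (\<rho> p - c / fact 6 * fst p ^ 6 + R p))"
  proof (rule right_equivalent_add_jacobian[OF \<open>0 < r\<close>])
    show "smooth_on (ball 0 r) (\<lambda>p. sextic_coeffs g + E p)"
      by (intro smooth_intros open_ball vanishing_smooth[OF cb E(1)])
    show "\<rho> p - c / fact 6 * fst p ^ 6 + R p = Re (zc p ^ 4 * quad (zc p) (sextic_coeffs g + E p))"
      if "p \<in> ball 0 r" for p
      unfolding nf E(2)[OF that] quad_add distrib_left by simp
  qed
  then have "right_equivalent (\<lambda>p. f5 p + c / fact 6 * fst p ^ 6) (\<lambda>p. f5 p + \<rho> p + R p)"
    by (simp add: algebra_simps)
  then show ?thesis
    using right_equivalent_sym laplacian3_hom_poly[of a] unfolding \<rho> c_def by blast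
qed

section \<open>Harmonic quintic forms\<close>

text \<open>The four coefficients of the cubic \<open>laplacian h\<close> give four relations among
  six unknowns; the two free parameters are the real and imaginary part of \<open>A\<close>.\<close>

lemma harmonic_quintic:
  assumes "homogeneous_polynomial 5 h" "h \<noteq> (\<lambda>p. 0)" "harmonic h"
  obtains A where "A \<noteq> 0" "\<And>p. h p = Re (A * zc p ^ 5)"
proof -
  obtain a where h: "h = hom_poly 5 a" using assms(1) by (auto simp: homogeneous_polynomial_iff)
  have 5: "{..5::nat} = {0,1,2,3,4,5}" and 3: "{..3::nat} = {0,1,2,3}" by auto
  define b where "b i = real (Suc i) * real (Suc (Suc i)) * a (Suc (Suc i))
      + real (Suc 3 - i) * real (Suc (Suc 3) - i) * a i" for i
  have "laplacian (hom_poly (Suc (Suc 3)) a) = hom_poly 3 b"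
    unfolding laplacian_hom_poly b_def ..
  moreover have "Suc (Suc 3) = 5" by simp
  ultimately have b: "hom_poly 3 b p = 0" for p
    using assms(3) by (simp only: h harmonic_def)
  \<comment> \<open>The values of the cubic at four points separate its coefficients.\<close>
  have "b 0 = 0" "b 3 = 0" "b 0 + b 1 + b 2 + b 3 = 0" "b 1 - b 0 - b 2 + b 3 = 0"
    using b[of "(0, 1)"] b[of "(1, 0)"] b[of "(1, 1)"] b[of "(1, - 1)"]
    by (simp_all add: hom_poly_def 3)
  then have b0: "b 0 = 0" "b 1 = 0" "b 2 = 0" "b 3 = 0" by linarith+
  then have a: "a 2 = - 10 * a 0" "a 3 = - 2 * a 1" "a 4 = 5 * a 0" "5 * a 5 = a 1"
    unfolding b_def by (simp_all add: eval_nat_numeral)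
  \<comment> \<open>The constant is read off at (1, 0) and (0, 1), where \<open>zc p ^ 5\<close> is
    1 and \<i>.\<close>
  have eq: "h p = Re (Complex (a 5) (- a 0) * zc p ^ 5)" for p
  proof -
    obtain x y where p: "p = (x, y)" by (cases p)
    have "a 1 = 5 * a 5" "a 3 = - 10 * a 5" using a by linarith+
    then show ?thesis
      unfolding h hom_poly_def 5 p zc_def using a(1,3)
      by (simp add: eval_nat_numeral algebra_simps)
  qed
  have "Complex (a 5) (- a 0) \<noteq> 0"
  proof
    assume "Complex (a 5) (- a 0) = 0"
    then have "h = (\<lambda>p. 0)" using eq by (simp add: fun_eq_iff)
    then show False using assms(2) by contradiction
  qed
  then show thesis using that eq by blast
qed

section \<open>Multiplication by a complex number as a conformal map\<close>

definition cmult :: "complex \<Rightarrow> plane \<Rightarrow> plane" where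
  "cmult u p = (Re (u * zc p), Im (u * zc p))"

lemma zc_cmult [simp]: "zc (cmult u p) = u * zc p"
  by (simp add: zc_def cmult_def complex_eq_iff)

lemma zc_inj: "zc p = zc q \<longleftrightarrow> p = q"
  by (auto simp: zc_def prod_eq_iff)

lemma norm_zc: "norm (zc p) = norm p"
  by (cases p) (simp add: zc_def norm_Pair cmod_def)

lemma linear_cmult: "linear (cmult u)"
  by (rule linearI) (simp_all add: cmult_def zc_def algebra_simps)

lemma cmult_0 [simp]: "cmult u 0 = 0"
  by (rule linear_0[OF linear_cmult])

lemma linear_conformal_cmult:
  assumes "u \<noteq> 0"
  shows "linear_conformal (cmult u)"
proof -
  have "orthogonal_transformation (cmult (u / norm u))"
    unfolding orthogonal_transformation using assms
    by (simp add: linear_cmult norm_zc[symmetric] norm_mult norm_divide)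
  moreover have "cmult u p = norm u *\<^sub>R cmult (u / norm u) p" for p
    using assms by (simp add: cmult_def)
  ultimately show ?thesis unfolding linear_conformal_def using assms
    by (intro exI[of _ "norm u"] exI[of _ "cmult (u / norm u)"]) auto
qed

lemma diffeo_germ_cmult:
  assumes "u \<noteq> 0"
  shows "diffeo_germ (cmult u)"
proof (rule diffeo_germ_smooth[OF open_UNIV UNIV_I])
  have bl: "bounded_linear (cmult u)" using linear_cmult by (simp add: linear_conv_bounded_linear)
  then show "smooth_on UNIV (cmult u)" by (rule smooth_on_linear[OF open_UNIV])
  show "cmult u 0 = 0" by simp
  have "frechet_derivative (cmult u) (at 0) = cmult u"
    using bounded_linear_imp_has_derivative[OF bl] by (rule frechet_derivative_at[symmetric])
  moreover have "inj (cmult u)"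
  proof (rule injI)
    fix p q assume "cmult u p = cmult u q"
    then have "u * zc p = u * zc q" by (metis zc_cmult)
    then show "p = q" using assms by (simp add: zc_inj)
  qed
  ultimately show "inj (frechet_derivative (cmult u) (at 0))" by simp
qed

text \<open>The bound passes through ideal powers, which pull back under any smooth map; the
  coordinates of \<open>cmult u p\<close> are linear in those of \<open>p\<close>. No higher chain
  rule for partial derivatives is involved.\<close>

lemma germ_order_cmult:
  assumes "function_germ R" "enat n \<le> germ_order R"
  shows "function_germ (\<lambda>p. R (cmult u p))" "enat n \<le> germ_order (\<lambda>p. R (cmult u p))"
proof -
  obtain r where "0 < r" and sR: "smooth_on (ball 0 r) R"
    using smooth_on_ball_of_germ[OF assms(1)] .
  have bl: "bounded_linear (cmult u)" using linear_cmult by (simp add: linear_conv_bounded_linear)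
  define S where "S = cmult u -` ball 0 r"
  have S: "open S" unfolding S_def
    by (intro open_vimage open_ball linear_continuous_on bl)
  have S0: "0 \<in> S" using \<open>0 < r\<close> by (simp add: S_def)
  have su: "smooth_on S (cmult u)" by (rule smooth_on_linear[OF S bl])
  have im: "cmult u ` S \<subseteq> ball 0 r" by (auto simp: S_def)
  note cS = S smooth_on_ident[OF S]
  have "vanishing S (\<lambda>p. p) n (\<lambda>p. R (cmult u p))"
  proof (rule vanishing_change_coordinates[OF cS, of "cmult u"])
    show "vanishing S (cmult u) n (\<lambda>p. R (cmult u p))"
      using vanishing_pullback[OF S open_ball su im germ_order_imp_vanishing[OF assms(2) sR \<open>0 < r\<close>]] .
    show "vanishing S (\<lambda>p. p) 1 (\<lambda>p. fst (cmult u p))" unfolding One_nat_def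
      by (rule vanishing_SucI[of _ _ _ "\<lambda>p. Re u" "\<lambda>p. - Im u"])
        (simp_all add: smooth_on_const cmult_def zc_def)
    show "vanishing S (\<lambda>p. p) 1 (\<lambda>p. snd (cmult u p))" unfolding One_nat_def
      by (rule vanishing_SucI[of _ _ _ "\<lambda>p. Im u" "\<lambda>p. Re u"])
        (simp_all add: smooth_on_const cmult_def zc_def)
  qed
  then show "enat n \<le> germ_order (\<lambda>p. R (cmult u p))"
    by (rule vanishing_imp_germ_order[OF S S0])
  show "function_germ (\<lambda>p. R (cmult u p))"
    unfolding function_germ_def using assms(1) S S0 smooth_on_compose[OF S open_ball sR su im]
    by (auto simp: function_germ_def)
qed

lemma quintic_normal_form:
  assumes "homogeneous_polynomial 5 h5" "h5 \<noteq> (\<lambda>p. 0)" "harmonic h5"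
    and R: "function_germ R6" "germ_order R6 \<ge> 6"
    and h: "\<forall>\<^sub>F p in nhds 0. h p = h5 p + R6 p"
  shows "\<exists>R6'. function_germ R6' \<and> germ_order R6' \<ge> 6 \<and>
    linear_conformally_right_equivalent h (\<lambda>p. f5 p + R6' p)"
proof -
  obtain A where "A \<noteq> 0" and A: "\<And>p. h5 p = Re (A * zc p ^ 5)"
    using harmonic_quintic[OF assms(1-3)] by metis
  \<comment> \<open>A fifth root of \<open>1 / A\<close>, so that Re (A (u z)^5) = Re (z^5).\<close>
  define u where "u = exp (Ln (1 / A) / 5)"
  have "u ^ 5 = exp (of_nat 5 * (Ln (1 / A) / 5))" unfolding u_def by (rule exp_of_nat_mult[symmetric])
  then have u: "u ^ 5 = 1 / A" "u \<noteq> 0" using \<open>A \<noteq> 0\<close> by (simp_all add: u_def)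
  have h5: "h5 (cmult u p) = f5 p" for p
    using \<open>A \<noteq> 0\<close> by (simp add: A f5_eq power_mult_distrib u)
  have "isCont (cmult u) 0"
    using linear_cmult by (simp add: linear_conv_bounded_linear linear_continuous_at)
  then have "filterlim (cmult u) (nhds (cmult u 0)) (nhds 0)"
    unfolding isCont_def tendsto_at_iff_tendsto_nhds .
  then have "filterlim (cmult u) (nhds 0) (nhds 0)" by (simp only: cmult_0)
  from filterlim_iff[THEN iffD1, OF this, rule_format, OF h]
  have "\<forall>\<^sub>F p in nhds 0. h (cmult u p) = f5 p + R6 (cmult u p)" by (simp add: h5)
  then have "linear_conformally_right_equivalent h (\<lambda>p. f5 p + R6 (cmult u p))"
    unfolding linear_conformally_right_equivalent_def right_equivalent_via_def
    using linear_conformal_cmult[OF u(2)] diffeo_germ_cmult[OF u(2)] by blast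
  moreover have "6 \<le> germ_order (\<lambda>p. R6 (cmult u p))"
    using germ_order_cmult(2)[OF R(1), of 6 u] R(2) by (simp add: numeral_eq_enat)
  moreover have "function_germ (\<lambda>p. R6 (cmult u p))"
    using germ_order_cmult(1)[OF R(1), of 0 u] by (simp add: zero_enat_def[symmetric])
  ultimately show ?thesis by blast
qed

section \<open>The modulus is an invariant\<close>

lemma Re_of_real_mult: "Re (of_real a * z) = a * Re z"
  by simp

text \<open>Extracts the parts of degree 5 and 6 along a line when the second-order remainder
  \<open>K\<close> is only known to converge: divide by \<open>r^5\<close> and let \<open>r\<close>
  tend to 0, then cancel the limit, divide by \<open>r\<close> and pass to the limit again.\<close>

lemma two_jet_along_line:
  fixes L K0 :: complex and K :: "real \<Rightarrow> complex" and c c' m q :: real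
  assumes K: "(K \<longlongrightarrow> K0) (at 0)"
    and eq: "\<forall>\<^sub>F r in at 0. Re ((of_real r * L + of_real r ^ 2 * K r) ^ 5)
      + c * Re (of_real r * L + of_real r ^ 2 * K r) ^ 6 = r ^ 5 * q + c' * (r ^ 6 * m)"
  shows "Re (L ^ 5) = q" and "5 * Re (L ^ 4 * K0) + c * Re L ^ 6 = c' * m"
proof -
  have nz: "\<forall>\<^sub>F r::real in at 0. r \<noteq> 0" by (simp add: eventually_at_filter)
  have first: "\<forall>\<^sub>F r in at 0. Re ((L + of_real r * K r) ^ 5) + c * (r * Re (L + of_real r * K r) ^ 6)
      = q + c' * (r * m)"
    using eq nz
  proof eventually_elim
    case (elim r)
    have s: "of_real r * L + of_real r ^ 2 * K r = of_real r * (L + of_real r * K r)"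
      by (simp add: power2_eq_square algebra_simps)
    have 5: "Re ((of_real r * w) ^ 5) = r ^ 5 * Re (w ^ 5)" for w
      by (simp add: power_mult_distrib flip: of_real_power)
    have 6: "Re (of_real r * w) ^ 6 = r ^ 6 * Re w ^ 6" for w
      by (simp add: power_mult_distrib)
    have "r ^ 5 * (Re ((L + of_real r * K r) ^ 5) + c * (r * Re (L + of_real r * K r) ^ 6)) =
        r ^ 5 * Re ((L + of_real r * K r) ^ 5) + c * (r ^ 6 * Re (L + of_real r * K r) ^ 6)"
      by (simp add: eval_nat_numeral algebra_simps)
    also have "\<dots> = r ^ 5 * q + c' * (r ^ 6 * m)" using elim(1) unfolding s 5 6 .
    also have "\<dots> = r ^ 5 * (q + c' * (r * m))"
      by (simp add: eval_nat_numeral algebra_simps)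
    finally show ?case using elim(2) by simp
  qed
  have r: "((\<lambda>r::real. r) \<longlongrightarrow> 0) (at 0)" by (rule tendsto_ident_at)
  have rc: "((\<lambda>r::real. of_real r :: complex) \<longlongrightarrow> of_real 0) (at 0)" by (intro tendsto_of_real r)
  let ?F = "\<lambda>r. Re ((L + of_real r * K r) ^ 5) + c * (r * Re (L + of_real r * K r) ^ 6)"
  have lim1: "(?F \<longlongrightarrow> Re ((L + of_real 0 * K0) ^ 5) + c * (0 * Re (L + of_real 0 * K0) ^ 6)) (at 0)"
    by (intro tendsto_intros K r rc)
  have "((\<lambda>r. q + c' * (r * m)) \<longlongrightarrow> q + c' * (0 * m)) (at 0)"
    by (intro tendsto_intros r)
  then have lim2: "(?F \<longlongrightarrow> q + c' * (0 * m)) (at 0)"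
    using tendsto_cong[OF first] by blast
  show q: "Re (L ^ 5) = q"
    using tendsto_unique[OF at_neq_bot lim1 lim2] by simp
  \<comment> \<open>The difference quotient of \<open>(L + r k)^5\<close> against
    \<open>L^5\<close>, written as a polynomial so that its limit is obtained by
    substitution.\<close>
  let ?M = "\<lambda>r k. 5 * (L ^ 4 * k) + of_real r * (10 * (L ^ 3 * k ^ 2) + 10 * of_real r * (L ^ 2 * k ^ 3)
      + 5 * of_real r ^ 2 * (L * k ^ 4) + of_real r ^ 3 * k ^ 5)"
  have second: "\<forall>\<^sub>F r in at 0. Re (?M r (K r)) + c * Re (L + of_real r * K r) ^ 6 = c' * m"
    using first nz
  proof eventually_elim
    case (elim r)
    have "(L + of_real r * K r) ^ 5 = L ^ 5 + of_real r * ?M r (K r)"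
      by (simp add: eval_nat_numeral algebra_simps)
    then have "Re ((L + of_real r * K r) ^ 5) = q + r * Re (?M r (K r))" using q by simp
    then have "r * (Re (?M r (K r)) + c * Re (L + of_real r * K r) ^ 6) = r * (c' * m)"
      using elim(1) by (simp only: distrib_left mult.left_commute)
    then show ?case using elim(2) by simp
  qed
  have "((\<lambda>r. Re (?M r (K r)) + c * Re (L + of_real r * K r) ^ 6)
      \<longlongrightarrow> Re (?M 0 K0) + c * Re (L + of_real 0 * K0) ^ 6) (at 0)"
    by (intro tendsto_intros K rc)
  then have "((\<lambda>r::real. c' * m) \<longlongrightarrow> Re (?M 0 K0) + c * Re (L + of_real 0 * K0) ^ 6) (at 0)"
    using tendsto_cong[OF second] by simp
  then have "c' * m = Re (?M 0 K0) + c * Re (L + of_real 0 * K0) ^ 6"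
    by (intro tendsto_unique[OF _ tendsto_const]) auto
  then show "5 * Re (L ^ 4 * K0) + c * Re L ^ 6 = c' * m" by simp
qed

text \<open>The relations \<open>e k + e (k + 2) = 0\<close> below say that \<open>f5\<close> composed with the linear map is
  harmonic. If \<open>P\<^sup>2 + Q\<^sup>2\<close> were non-zero, they would force \<open>Q / P\<close> to be real, against
  \<open>Re (P\<^sup>3 (P\<^sup>2 + Q\<^sup>2)) = 0\<close> and \<open>Re (P\<^sup>5) = 1\<close>.\<close>

lemma f5_stabilizer:
  fixes P Q :: complex
  assumes "\<And>a b. Re ((of_real a * P + of_real b * Q) ^ 5) = Re (Complex a b ^ 5)"
  shows "Q = \<i> * P \<or> Q = - (\<i> * P)" and "norm P = 1"
proof -
  define e where "e k = Re (P ^ (5 - k) * Q ^ k)" for k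
  have lhs: "Re ((P + of_real t * Q) ^ 5) =
      e 0 + 5 * t * e 1 + 10 * t ^ 2 * e 2 + 10 * t ^ 3 * e 3 + 5 * t ^ 4 * e 4 + t ^ 5 * e 5" for t
  proof -
    have "(P + of_real t * Q) ^ 5 = P ^ 5 + of_real (5 * t) * (P ^ 4 * Q) + of_real (10 * t ^ 2) * (P ^ 3 * Q ^ 2)
      + of_real (10 * t ^ 3) * (P ^ 2 * Q ^ 3) + of_real (5 * t ^ 4) * (P * Q ^ 4) + of_real (t ^ 5) * Q ^ 5"
      by (simp add: eval_nat_numeral algebra_simps)
    then show ?thesis by (simp only: plus_complex.sel Re_of_real_mult e_def) simp
  qed
  have rhs: "Re (Complex 1 t ^ 5) = 1 - 10 * t ^ 2 + 5 * t ^ 4" for t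
    by (simp add: eval_nat_numeral algebra_simps)
  have poly: "e 0 + 5 * t * e 1 + 10 * t ^ 2 * e 2 + 10 * t ^ 3 * e 3 + 5 * t ^ 4 * e 4 + t ^ 5 * e 5
      = 1 - 10 * t ^ 2 + 5 * t ^ 4" for t
    using assms[of 1 t] by (simp only: of_real_1 mult_1_left lhs rhs)
  \<comment> \<open>Six values of \<open>t\<close> determine the six coefficients of a polynomial of
    degree 5.\<close>
  have e: "e 0 = 1" "e 5 = 0" "e 1 = 0" "e 2 = - 1" "e 3 = 0" "e 4 = 1"
    using poly[of 0] poly[of 1] poly[of "-1"] poly[of 2] poly[of "-2"] poly[of 3] by simp_all
  define W where "W = P ^ 2 + Q ^ 2"
  have ReP5: "Re (P ^ 5) = 1" using e(1) by (simp add: e_def)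
  then have "P \<noteq> 0" by auto
  have "W = 0"
  proof (rule ccontr)
    assume "W \<noteq> 0"
    define U where "U = P ^ 3 * W"
    define s where "s = Q / P"
    have Q: "Q = s * P" using \<open>P \<noteq> 0\<close> by (simp add: s_def)
    have "U = P ^ 5 + P ^ 3 * Q ^ 2"
      by (simp add: U_def W_def eval_nat_numeral algebra_simps)
    then have ReU: "Re U = 0" using e(1,4) by (simp add: e_def)
    have "U * s = P ^ 4 * Q + P ^ 2 * Q ^ 3"
      unfolding U_def W_def Q by (simp add: eval_nat_numeral algebra_simps)
    then have "Re (U * s) = 0" using e(3,5) by (simp add: e_def)
    then have "Im U * Im s = 0" using ReU by simp
    moreover have "Im U \<noteq> 0"
      using ReU \<open>W \<noteq> 0\<close> \<open>P \<noteq> 0\<close> unfolding U_def by (metis complex_eqI mult_eq_0_iff power_not_zero zero_complex.sel)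
    ultimately have s: "s = of_real (Re s)" by (simp add: complex_eq_iff)
    have "U = of_real (1 + Re s ^ 2) * P ^ 5"
      unfolding U_def W_def Q by (subst (1) s) (simp add: eval_nat_numeral algebra_simps)
    then have "Re U = (1 + Re s ^ 2) * Re (P ^ 5)" by (simp only: Re_of_real_mult)
    then have "1 + Re s ^ 2 = 0" using ReU ReP5 by simp
    then show False by (smt (verit) zero_le_power2)
  qed
  then have "(Q - \<i> * P) * (Q + \<i> * P) = 0"
    by (simp add: W_def power2_eq_square algebra_simps)
  then show Q: "Q = \<i> * P \<or> Q = - (\<i> * P)"
    by (simp add: eq_neg_iff_add_eq_0)
  \<comment> \<open>So \<open>Q ^ 5\<close> is \<plusminus>\<i> \<open>P ^ 5\<close>, and
    \<open>e 5 = 0\<close> says that \<open>P ^ 5\<close> is real; with real part 1 it equals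
    1.\<close>
  have "\<i> ^ 5 = \<i>" by (simp add: eval_nat_numeral)
  then have "Im (P ^ 5) = 0"
    using Q e(2) by (auto simp: e_def power_mult_distrib)
  then have "P ^ 5 = 1" using ReP5 by (simp add: complex_eq_iff)
  then have "norm P ^ 5 = 1" by (metis norm_power norm_one)
  then show "norm P = 1" using power_eq_imp_eq_base[of "norm P" 5 1] by simp
qed

text \<open>The combination \<open>8 G(1, 0) + 8 G(0, 1) + G(1, 1) + G(1, - 1)\<close> of values of a sextic form \<open>G\<close>
  is a multiple of \<open>\<Delta>\<^sup>3 G\<close>, so it kills the tangent directions \<open>5 Re (z\<^sup>4 k(z))\<close>.\<close>

lemma modulus_from_sextic_part:
  fixes P Q A B C :: complex and c c' :: real
  assumes Q: "Q = \<i> * P \<or> Q = - (\<i> * P)" and P: "norm P = 1"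
    and eq: "\<And>a b. 5 * Re ((of_real a * P + of_real b * Q) ^ 4 *
        (of_real (a ^ 2) * A + of_real (a * b) * B + of_real (b ^ 2) * C))
      + c * Re (of_real a * P + of_real b * Q) ^ 6 = c' * a ^ 6"
  shows "c = c'"
proof -
  let ?p = "Re P" and ?q = "Im P"
  \<comment> \<open>Here (1 \<plusminus> \<i>)^4 = -4. The values at (1, 1) and (1, -1) thus
    contribute -8 times the tangent terms of \<open>A\<close> and \<open>C\<close>, balancing the
    weights 8 of the other two points, while \<open>B\<close> cancels.\<close>
  have Q4: "Q ^ 4 = P ^ 4" and PQ: "(P + Q) ^ 4 = - 4 * P ^ 4" "(P - Q) ^ 4 = - 4 * P ^ 4"
    using Q by (auto simp: eval_nat_numeral algebra_simps)
  have 1: "5 * Re (P ^ 4 * A) + c * ?p ^ 6 = c'"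
    using eq[of 1 0] by simp
  have 2: "5 * Re (P ^ 4 * C) + c * ?q ^ 6 = 0"
    using eq[of 0 1] Q Q4 by auto
  have 3: "5 * Re (- 4 * P ^ 4 * (A + B + C)) + c * Re (P + Q) ^ 6 = c'"
    using eq[of 1 1] by (simp only: of_real_1 mult_1_left power_one PQ mult_1_right)
  have 4: "5 * Re (- 4 * P ^ 4 * (A - B + C)) + c * Re (P - Q) ^ 6 = c'"
    using eq[of 1 "-1"] PQ by simp
  have sq: "?p ^ 2 + ?q ^ 2 = 1" using P by (simp add: cmod_def)
  have "Re (P + Q) ^ 6 + Re (P - Q) ^ 6 = (?p + ?q) ^ 6 + (?p - ?q) ^ 6" using Q by auto
  moreover have "Re (- 4 * P ^ 4 * (A + B + C)) + Re (- 4 * P ^ 4 * (A - B + C))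
      = - 8 * (Re (P ^ 4 * A) + Re (P ^ 4 * C))"
    by (simp add: algebra_simps)
  ultimately have "c * (8 * ?p ^ 6 + 8 * ?q ^ 6 + (?p + ?q) ^ 6 + (?p - ?q) ^ 6) = 10 * c'"
    using 1 2 3 4 by algebra
  moreover have "8 * ?p ^ 6 + 8 * ?q ^ 6 + (?p + ?q) ^ 6 + (?p - ?q) ^ 6 = 10 * (?p ^ 2 + ?q ^ 2) ^ 3"
    by (simp add: eval_nat_numeral algebra_simps)
  ultimately show ?thesis using sq by simp
qed

text \<open>Two applications of Hadamard's lemma write \<tau> along the line through (a, b) as t L +
  t^2 K t, where L = a g 0 + b h 0 and K converges at 0. The numbers \<open>g 0\<close> and
  \<open>h 0\<close> describe the linear part of \<tau> and take the roles of \<open>P\<close> and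
  \<open>Q\<close>; \<open>A\<close>, \<open>B\<close>, \<open>C\<close> are the coefficients of its
  quadratic part.\<close>

lemma modulus_invariant:
  assumes "right_equivalent (\<lambda>p. f5 p + c * fst p ^ 6) (\<lambda>p. f5 p + c' * fst p ^ 6)"
  shows "c = c'"
proof -
  obtain \<tau> U where \<tau>0: "\<tau> 0 = 0" and U: "open U" "0 \<in> U" and s\<tau>: "smooth_on U \<tau>"
    and eq: "\<forall>\<^sub>F p in nhds 0. f5 (\<tau> p) + c * fst (\<tau> p) ^ 6 = f5 p + c' * fst p ^ 6"
    using assms unfolding right_equivalent_def right_equivalent_via_def diffeo_germ_def by blast
  obtain r where "0 < r" and rU: "ball 0 r \<subseteq> U" using U by (meson open_contains_ball)
  let ?B = "ball (0::plane) r"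
  have "bounded_linear zc"
    unfolding linear_conv_bounded_linear[symmetric]
    by (rule linearI) (simp_all add: zc_def complex_eq_iff)
  then have sT: "smooth_on ?B (\<lambda>p. zc (\<tau> p))"
    by (rule smooth_on_linear_compose[OF open_ball]) (rule smooth_on_subset[OF s\<tau> rU])
  have split: "\<exists>g h. smooth_on ?B g \<and> smooth_on ?B h \<and>
      (\<forall>p\<in>?B. f p = f 0 + fst p *\<^sub>R g p + snd p *\<^sub>R h p)" if f: "smooth_on ?B f" for f :: "plane \<Rightarrow> complex"
    using hadamard[OF f] unfolding One_nat_def vanishing.simps by (auto simp: algebra_simps)
  obtain g h where gh: "smooth_on ?B g" "smooth_on ?B h"
    and T: "\<And>p. p \<in> ?B \<Longrightarrow> zc (\<tau> p) = fst p *\<^sub>R g p + snd p *\<^sub>R h p"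
    using split[OF sT] by (auto simp: \<tau>0)
  obtain g1 g2 where g12: "smooth_on ?B g1" "smooth_on ?B g2"
    and g: "\<And>p. p \<in> ?B \<Longrightarrow> g p = g 0 + fst p *\<^sub>R g1 p + snd p *\<^sub>R g2 p"
    using split[OF gh(1)] by blast
  obtain h1 h2 where h12: "smooth_on ?B h1" "smooth_on ?B h2"
    and h: "\<And>p. p \<in> ?B \<Longrightarrow> h p = h 0 + fst p *\<^sub>R h1 p + snd p *\<^sub>R h2 p"
    using split[OF gh(2)] by blast
  define A where "A = g1 0"
  define B where "B = g2 0 + h1 0"
  define C where "C = h2 0"
  have key: "Re ((of_real a * g 0 + of_real b * h 0) ^ 5) = Re (Complex a b ^ 5)"
    "5 * Re ((of_real a * g 0 + of_real b * h 0) ^ 4 *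
        (of_real (a ^ 2) * A + of_real (a * b) * B + of_real (b ^ 2) * C))
      + c * Re (of_real a * g 0 + of_real b * h 0) ^ 6 = c' * a ^ 6" for a b
  proof -
    define K where "K t = of_real (a ^ 2) * g1 (t * a, t * b)
      + of_real (a * b) * (g2 (t * a, t * b) + h1 (t * a, t * b)) + of_real (b ^ 2) * h2 (t * a, t * b)" for t
    have lim: "((\<lambda>t. (t * a, t * b)) \<longlongrightarrow> 0) (at 0)"
      by (auto intro!: tendsto_eq_intros simp: zero_prod_def)
    have tk: "((\<lambda>t. k (t * a, t * b)) \<longlongrightarrow> k 0) (at 0)" if "smooth_on ?B k" for k :: "plane \<Rightarrow> complex"
    proof -
      have "isCont k 0" using smooth_on_imp_continuous_on[OF that] \<open>0 < r\<close>
        by (simp add: continuous_on_eq_continuous_at)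
      then show ?thesis using lim by (rule isCont_tendsto_compose)
    qed
    have K: "(K \<longlongrightarrow> of_real (a ^ 2) * A + of_real (a * b) * B + of_real (b ^ 2) * C) (at 0)"
      unfolding K_def A_def B_def C_def by (intro tendsto_intros tk g12 h12)
    have "\<forall>\<^sub>F p in nhds 0. p \<in> ?B" using \<open>0 < r\<close> by (intro eventually_nhds_in_open) auto
    from eventually_conj[OF this eq] lim
    have "\<forall>\<^sub>F t in at 0. (t * a, t * b) \<in> ?B \<and> f5 (\<tau> (t * a, t * b)) + c * fst (\<tau> (t * a, t * b)) ^ 6
        = f5 (t * a, t * b) + c' * fst (t * a, t * b) ^ 6"
      by (rule filterlim_iff[THEN iffD1, rule_format, rotated])
    then have "\<forall>\<^sub>F t in at 0. Re ((of_real t * (of_real a * g 0 + of_real b * h 0) + of_real t ^ 2 * K t) ^ 5)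
      + c * Re (of_real t * (of_real a * g 0 + of_real b * h 0) + of_real t ^ 2 * K t) ^ 6
      = t ^ 5 * Re (Complex a b ^ 5) + c' * (t ^ 6 * a ^ 6)"
    proof eventually_elim
      case (elim t)
      then have B: "(t * a, t * b) \<in> ?B" by blast
      have "zc (\<tau> (t * a, t * b)) = of_real t * (of_real a * g 0 + of_real b * h 0) + of_real t ^ 2 * K t"
        unfolding T[OF B] g[OF B] h[OF B] K_def
        by (simp add: scaleR_conv_of_real power2_eq_square algebra_simps)
      moreover have "fst (\<tau> (t * a, t * b)) = Re (zc (\<tau> (t * a, t * b)))" by (simp add: zc_def)
      moreover have "f5 (t * a, t * b) = t ^ 5 * Re (Complex a b ^ 5)"
      proof -
        have "zc (t * a, t * b) ^ 5 = of_real (t ^ 5) * Complex a b ^ 5"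
          by (simp add: zc_def power_mult_distrib[symmetric] complex_of_real_mult_Complex)
        then show ?thesis by (simp only: f5_eq Re_of_real_mult)
      qed
      ultimately show ?case using elim by (simp add: f5_eq power_mult_distrib)
    qed
    from two_jet_along_line[OF K this]
    show "Re ((of_real a * g 0 + of_real b * h 0) ^ 5) = Re (Complex a b ^ 5)"
      "5 * Re ((of_real a * g 0 + of_real b * h 0) ^ 4 *
        (of_real (a ^ 2) * A + of_real (a * b) * B + of_real (b ^ 2) * C))
      + c * Re (of_real a * g 0 + of_real b * h 0) ^ 6 = c' * a ^ 6" by simp_all
  qed
  show ?thesis
    using modulus_from_sextic_part[OF f5_stabilizer[OF key(1)] key(2)] .
qed

lemma right_equivalent_refl: "right_equivalent h h"
proof -
  have D: "frechet_derivative (\<lambda>p. p) (at 0) = (\<lambda>p::plane. p)" by simp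
  have "diffeo_germ (\<lambda>p. p)"
    by (rule diffeo_germ_smooth[OF open_UNIV]) (simp_all add: smooth_on_ident D)
  then show ?thesis unfolding right_equivalent_def right_equivalent_via_def by auto
qed

theorem theorem1:
  shows
    "(\<forall>h h5 R6.
        homogeneous_polynomial 5 h5 \<and> h5 \<noteq> (\<lambda>p. 0) \<and> harmonic h5 \<and>
        function_germ R6 \<and> germ_order R6 \<ge> 6 \<and>
        function_germ h \<and> (\<forall>\<^sub>F p in nhds 0. h p = h5 p + R6 p) \<longrightarrow>
        (\<exists>R6'. function_germ R6' \<and> germ_order R6' \<ge> 6 \<and>
           linear_conformally_right_equivalent h (\<lambda>p. f5 p + R6' p)))
     \<and>
     (\<forall>\<rho>6 R7.
        homogeneous_polynomial 6 \<rho>6 \<and> function_germ R7 \<and> germ_order R7 \<ge> 7 \<longrightarrow>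
        (\<exists>c. (laplacian ^^ 3) \<rho>6 = (\<lambda>p. c) \<and>
           right_equivalent (\<lambda>p. f5 p + \<rho>6 p + R7 p)
             (\<lambda>p. f5 p + c / fact 6 * fst p ^ 6)))
     \<and>
     (\<forall>c c' :: real.
        right_equivalent (\<lambda>p. f5 p + c * fst p ^ 6) (\<lambda>p. f5 p + c' * fst p ^ 6)
        \<longleftrightarrow> c = c')"
proof (intro conjI allI impI)
  show "right_equivalent (\<lambda>p. f5 p + c * fst p ^ 6) (\<lambda>p. f5 p + c' * fst p ^ 6) \<longleftrightarrow> c = c'" for c c'
    using modulus_invariant right_equivalent_refl by blast
qed (elim conjE, rule quintic_normal_form sextic_normal_form; assumption)+

end
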